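(* Let $\Phi:M_n(\mathbb{C})\to M_n(\mathbb{C})$ be a completely positive map with Choi rank $2$. Then $\Phi$ is positively factorizable if and only if all entries of its Choi matrix $J(\Phi)$ are nonnegative.
   Context: A completely positive map $\Phi:M_n(\mathbb{C})\to M_n(\mathbb{C})$ has Kraus operators $K_1,\dots,K_d\in M_n(\mathbb{C})$ if $\Phi(X)=\sum_{i=1}^d K_iXK_i^*$ for all $X$. Its Choi rank is the minimal number of linearly independent Kraus operators needed to represent $\Phi$ in this way (equivalently the rank of $J(\Phi)$). The Choi matrix is $J(\Phi)=\sum_{i,j=1}^n E_{ij}\otimes\Phi(E_{ij})$, where $E_{ij}$ are the matrix units. $\Phi$ is positively factorizable if there exist a finite von Neumann algebra $\mathcal{A}$ with a faithful normal (finite) trace $\tau$ and $Z=(Z(i,j))\in M_n(\mathbb{C})\otimes\mathcal{A}=M_n(\mathcal{A})$, each entry $Z(i,j)$ being a positive element of $\mathcal{A}$, such that $\Phi(X)=(\mathrm{id}\otimes\tau)(Z(X\otimes 1_{\mathcal{A}})Z^* )$ for all $X\in M_n(\mathbb{C})$. *)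

theory Defs
  imports
    "HOL-Analysis.Analysis"
    "HOL-Library.Function_Algebras"
    "HOL-Library.Infinite_Typeclass"
    "HOL-Library.Extended_Nat"
begin

section \<open>Maps on \<open>M\<^sub>n(\<complex>)\<close>\<close>

text \<open>Throughout, \<open>M\<^sub>n(\<complex>)\<close> is \<open>complex^'n^'n\<close>, and multiplication of a matrix by the scalar \<open>c\<close> is
  written \<open>mat c ** X\<close>.\<close>

definition ctranspose :: "complex^'n^'m \<Rightarrow> complex^'m^'n" where
  "ctranspose A = (\<chi> i j. cnj (A $ j $ i))"

definition matrix_unit :: "'n \<Rightarrow> 'n \<Rightarrow> complex^'n^'n" where
  "matrix_unit i j = (\<chi> k l. if k = i \<and> l = j then 1 else 0)"

definition kronecker ::
    "complex^'m^'m \<Rightarrow> complex^'n^'n \<Rightarrow> complex^('m \<times> 'n)^('m \<times> 'n)" where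
  "kronecker A B = (\<chi> p q. A $ fst p $ fst q * B $ snd p $ snd q)"

definition choi ::
    "(complex^'n^'n \<Rightarrow> complex^'n^'n) \<Rightarrow> complex^('n::finite \<times> 'n)^('n \<times> 'n)" where
  "choi \<Phi> = (\<Sum>i\<in>UNIV. \<Sum>j\<in>UNIV. kronecker (matrix_unit i j) (\<Phi> (matrix_unit i j)))"

lemma choi_nth: "choi \<Phi> $ (i, k) $ (j, l) = \<Phi> (matrix_unit i j) $ k $ l"
proof -
  have "choi \<Phi> $ (i, k) $ (j, l) =
      (\<Sum>a\<in>UNIV. \<Sum>b\<in>UNIV. if a = i then if b = j then \<Phi> (matrix_unit a b) $ k $ l else 0 else 0)"
    unfolding choi_def kronecker_def matrix_unit_def
    by (auto simp: sum_component intro!: sum.cong)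
  also have "\<dots> = (\<Sum>a\<in>UNIV. if a = i then \<Phi> (matrix_unit a j) $ k $ l else 0)"
    by (intro sum.cong) (auto simp: sum.delta)
  also have "\<dots> = \<Phi> (matrix_unit i j) $ k $ l"
    by (simp add: sum.delta)
  finally show ?thesis .
qed

definition clinear_matrix_map :: "(complex^'n^'n \<Rightarrow> complex^'n::finite^'n) \<Rightarrow> bool" where
  "clinear_matrix_map \<Phi> \<longleftrightarrow>
     (\<forall>X Y. \<Phi> (X + Y) = \<Phi> X + \<Phi> Y) \<and> (\<forall>c X. \<Phi> (mat c ** X) = mat c ** \<Phi> X)"

text \<open>An element of \<open>M\<^sub>k(M\<^sub>n(\<complex>))\<close> is given by its blocks \<open>X a b\<close>, \<open>a, b < k\<close>. Membership of the
  quadratic form in \<open>\<real>\<^sub>\<ge>\<^sub>0\<close> includes that it is real, hence that the block matrix is Hermitian.\<close>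

definition block_psd :: "nat \<Rightarrow> (nat \<Rightarrow> nat \<Rightarrow> complex^'n::finite^'n) \<Rightarrow> bool" where
  "block_psd k X \<longleftrightarrow>
     (\<forall>v :: nat \<Rightarrow> complex^'n.
        (\<Sum>a<k. \<Sum>b<k. \<Sum>i\<in>UNIV. cnj (v a $ i) * (X a b *v v b) $ i) \<in> \<real>\<^sub>\<ge>\<^sub>0)"

definition completely_positive :: "(complex^'n^'n \<Rightarrow> complex^'n::finite^'n) \<Rightarrow> bool" where
  "completely_positive \<Phi> \<longleftrightarrow>
     clinear_matrix_map \<Phi> \<and> (\<forall>k X. block_psd k X \<longrightarrow> block_psd k (\<lambda>a b. \<Phi> (X a b)))"

definition kraus_representation ::
    "(complex^'n^'n \<Rightarrow> complex^'n::finite^'n) \<Rightarrow> nat \<Rightarrow> (nat \<Rightarrow> complex^'n^'n) \<Rightarrow> bool" where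
  "kraus_representation \<Phi> d K \<longleftrightarrow> (\<forall>X. \<Phi> X = (\<Sum>i<d. K i ** X ** ctranspose (K i)))"

definition independent_matrices :: "nat \<Rightarrow> (nat \<Rightarrow> complex^'n::finite^'n) \<Rightarrow> bool" where
  "independent_matrices d K \<longleftrightarrow>
     (\<forall>c. (\<Sum>i<d. mat (c i) ** K i) = 0 \<longrightarrow> (\<forall>i<d. c i = 0))"

text \<open>The value is \<open>\<infinity>\<close> for maps that have no Kraus representation.\<close>

definition choi_rank :: "(complex^'n^'n \<Rightarrow> complex^'n::finite^'n) \<Rightarrow> enat" where
  "choi_rank \<Phi> =
     (INF d \<in> {d. \<exists>K. independent_matrices d K \<and> kraus_representation \<Phi> d K}. enat d)"


section \<open>Von Neumann algebras with a trace\<close>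

text \<open>
  A Hilbert space is modelled as a linear subspace \<open>H\<close> of \<open>'i \<Rightarrow> complex\<close> (with pointwise
  operations) that carries an arbitrary complete inner product, linear in the first argument.
  Every complex vector space is isomorphic to such a subspace once \<open>'i\<close> is as large as one of its
  bases. An operator is a function on all of \<open>'i \<Rightarrow> complex\<close> that vanishes outside \<open>H\<close>; so operators
  that agree on \<open>H\<close> are equal, sums are pointwise, and products are compositions.
\<close>

definition cscale :: "complex \<Rightarrow> ('i \<Rightarrow> complex) \<Rightarrow> ('i \<Rightarrow> complex)" where
  "cscale c x = (\<lambda>i. c * x i)"

locale complex_hilbert_space =
  fixes H :: "('i \<Rightarrow> complex) set"
    and ip :: "('i \<Rightarrow> complex) \<Rightarrow> ('i \<Rightarrow> complex) \<Rightarrow> complex"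
  assumes zero_closed: "0 \<in> H"
    and add_closed: "x \<in> H \<Longrightarrow> y \<in> H \<Longrightarrow> x + y \<in> H"
    and scale_closed: "x \<in> H \<Longrightarrow> cscale c x \<in> H"
    and ip_add: "x \<in> H \<Longrightarrow> y \<in> H \<Longrightarrow> z \<in> H \<Longrightarrow> ip (x + y) z = ip x z + ip y z"
    and ip_scale: "x \<in> H \<Longrightarrow> y \<in> H \<Longrightarrow> ip (cscale c x) y = c * ip x y"
    and ip_commute: "x \<in> H \<Longrightarrow> y \<in> H \<Longrightarrow> ip y x = cnj (ip x y)"
    and ip_nonneg: "x \<in> H \<Longrightarrow> ip x x \<in> \<real>\<^sub>\<ge>\<^sub>0"
    and ip_eq_0: "x \<in> H \<Longrightarrow> ip x x = 0 \<Longrightarrow> x = 0"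
    and complete:
      "(\<And>n. X n \<in> H) \<Longrightarrow>
       (\<And>e. e > 0 \<Longrightarrow> \<exists>N. \<forall>m\<ge>N. \<forall>n\<ge>N. sqrt (Re (ip (X m - X n) (X m - X n))) < e) \<Longrightarrow>
       \<exists>l\<in>H. (\<lambda>n. sqrt (Re (ip (X n - l) (X n - l)))) \<longlonglongrightarrow> 0"
begin

definition hnorm :: "('i \<Rightarrow> complex) \<Rightarrow> real" where
  "hnorm x = sqrt (Re (ip x x))"

definition bounded_ops :: "(('i \<Rightarrow> complex) \<Rightarrow> ('i \<Rightarrow> complex)) set" where
  "bounded_ops =
     {a. (\<forall>x\<in>H. a x \<in> H) \<and> (\<forall>x. x \<notin> H \<longrightarrow> a x = 0) \<and>
         (\<forall>x\<in>H. \<forall>y\<in>H. a (x + y) = a x + a y) \<and>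
         (\<forall>c. \<forall>x\<in>H. a (cscale c x) = cscale c (a x)) \<and>
         (\<exists>C. \<forall>x\<in>H. hnorm (a x) \<le> C * hnorm x)}"

definition op_id :: "('i \<Rightarrow> complex) \<Rightarrow> ('i \<Rightarrow> complex)" where
  "op_id = (\<lambda>x. if x \<in> H then x else 0)"

definition op_scale ::
    "complex \<Rightarrow> (('i \<Rightarrow> complex) \<Rightarrow> ('i \<Rightarrow> complex)) \<Rightarrow> (('i \<Rightarrow> complex) \<Rightarrow> ('i \<Rightarrow> complex))" where
  "op_scale c a = (\<lambda>x. cscale c (a x))"

definition op_adj ::
    "(('i \<Rightarrow> complex) \<Rightarrow> ('i \<Rightarrow> complex)) \<Rightarrow> (('i \<Rightarrow> complex) \<Rightarrow> ('i \<Rightarrow> complex))" where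
  "op_adj a = (THE b. b \<in> bounded_ops \<and> (\<forall>x\<in>H. \<forall>y\<in>H. ip (a x) y = ip x (b y)))"

definition positive_op :: "(('i \<Rightarrow> complex) \<Rightarrow> ('i \<Rightarrow> complex)) \<Rightarrow> bool" where
  "positive_op a \<longleftrightarrow> a \<in> bounded_ops \<and> (\<forall>x\<in>H. ip (a x) x \<in> \<real>\<^sub>\<ge>\<^sub>0)"

definition op_le ::
    "(('i \<Rightarrow> complex) \<Rightarrow> ('i \<Rightarrow> complex)) \<Rightarrow> (('i \<Rightarrow> complex) \<Rightarrow> ('i \<Rightarrow> complex)) \<Rightarrow> bool" where
  "op_le a b \<longleftrightarrow> positive_op (b - a)"

definition commutant ::
    "(('i \<Rightarrow> complex) \<Rightarrow> ('i \<Rightarrow> complex)) set \<Rightarrow> (('i \<Rightarrow> complex) \<Rightarrow> ('i \<Rightarrow> complex)) set" where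
  "commutant S = {b \<in> bounded_ops. \<forall>a\<in>S. a \<circ> b = b \<circ> a}"

end

locale von_neumann_algebra = complex_hilbert_space H ip
  for H :: "('i \<Rightarrow> complex) set"
    and ip :: "('i \<Rightarrow> complex) \<Rightarrow> ('i \<Rightarrow> complex) \<Rightarrow> complex" +
  fixes A :: "(('i \<Rightarrow> complex) \<Rightarrow> ('i \<Rightarrow> complex)) set"
  assumes bounded: "A \<subseteq> bounded_ops"
    and adj_closed: "a \<in> A \<Longrightarrow> op_adj a \<in> A"
    and bicommutant: "commutant (commutant A) = A"

text \<open>Finite means that every isometry of the algebra is unitary.\<close>

locale finite_von_neumann_algebra = von_neumann_algebra +
  assumes finite: "v \<in> A \<Longrightarrow> op_adj v \<circ> v = op_id \<Longrightarrow> v \<circ> op_adj v = op_id"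

text \<open>The trace is finite (it is a functional defined on all of \<open>A\<close>) but need not satisfy
  \<open>\<tau> 1 = 1\<close>. Normality is preservation of suprema of bounded increasing nets of positive
  elements, formulated for directed sets.\<close>

locale faithful_normal_trace = finite_von_neumann_algebra H ip A
  for H :: "('i \<Rightarrow> complex) set"
    and ip :: "('i \<Rightarrow> complex) \<Rightarrow> ('i \<Rightarrow> complex) \<Rightarrow> complex"
    and A :: "(('i \<Rightarrow> complex) \<Rightarrow> ('i \<Rightarrow> complex)) set" +
  fixes \<tau> :: "(('i \<Rightarrow> complex) \<Rightarrow> ('i \<Rightarrow> complex)) \<Rightarrow> complex"
  assumes trace_add: "a \<in> A \<Longrightarrow> b \<in> A \<Longrightarrow> \<tau> (a + b) = \<tau> a + \<tau> b"
    and trace_scale: "a \<in> A \<Longrightarrow> \<tau> (op_scale c a) = c * \<tau> a"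
    and trace_positive: "a \<in> A \<Longrightarrow> positive_op a \<Longrightarrow> \<tau> a \<in> \<real>\<^sub>\<ge>\<^sub>0"
    and trace_commute: "a \<in> A \<Longrightarrow> b \<in> A \<Longrightarrow> \<tau> (a \<circ> b) = \<tau> (b \<circ> a)"
    and faithful: "a \<in> A \<Longrightarrow> positive_op a \<Longrightarrow> \<tau> a = 0 \<Longrightarrow> a = 0"
    and normal:
      "D \<subseteq> {d \<in> A. positive_op d} \<Longrightarrow> D \<noteq> {} \<Longrightarrow>
       (\<And>a b. a \<in> D \<Longrightarrow> b \<in> D \<Longrightarrow> \<exists>c\<in>D. op_le a c \<and> op_le b c) \<Longrightarrow>
       s \<in> A \<Longrightarrow> (\<And>d. d \<in> D \<Longrightarrow> op_le d s) \<Longrightarrow>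
       (\<And>b. b \<in> A \<Longrightarrow> (\<And>d. d \<in> D \<Longrightarrow> op_le d b) \<Longrightarrow> op_le s b) \<Longrightarrow>
       Re (\<tau> s) = (SUP d\<in>D. Re (\<tau> d))"


section \<open>Positive factorizability\<close>

text \<open>Matrices over an operator algebra, i.e. elements of \<open>M\<^sub>n(\<complex>) \<otimes> \<A>\<close>. The library product \<open>**\<close>
  cannot be used for them, as the product of operators is composition.\<close>

type_synonym ('i, 'n) op_matrix = "(('i \<Rightarrow> complex) \<Rightarrow> ('i \<Rightarrow> complex))^'n^'n"

definition opm_mult :: "('i, 'n::finite) op_matrix \<Rightarrow> ('i, 'n) op_matrix \<Rightarrow> ('i, 'n) op_matrix" where
  "opm_mult M N = (\<chi> i j. \<Sum>k\<in>UNIV. M $ i $ k \<circ> N $ k $ j)"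

context complex_hilbert_space
begin

definition opm_adj :: "('i, 'n::finite) op_matrix \<Rightarrow> ('i, 'n) op_matrix" where
  "opm_adj M = (\<chi> i j. op_adj (M $ j $ i))"

text \<open>\<open>X \<otimes> 1\<close>\<close>

definition opm_ampliation :: "complex^'n::finite^'n \<Rightarrow> ('i, 'n) op_matrix" where
  "opm_ampliation X = (\<chi> i j. op_scale (X $ i $ j) op_id)"

end

text \<open>\<open>id \<otimes> \<tau>\<close>\<close>

definition opm_trace ::
    "((('i \<Rightarrow> complex) \<Rightarrow> ('i \<Rightarrow> complex)) \<Rightarrow> complex) \<Rightarrow> ('i, 'n::finite) op_matrix \<Rightarrow> complex^'n^'n" where
  "opm_trace \<tau> M = (\<chi> i j. \<tau> (M $ i $ j))"

text \<open>HOL cannot quantify existentially over types, so the size of the Hilbert spaces allowed is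
  bounded by the index type \<open>'i\<close>, which is a parameter. A theorem that is polymorphic in \<open>'i\<close> covers
  Hilbert spaces of every size.\<close>

definition positively_factorizable ::
    "'i itself \<Rightarrow> (complex^'n^'n \<Rightarrow> complex^'n::finite^'n) \<Rightarrow> bool" where
  "positively_factorizable _ \<Phi> \<longleftrightarrow>
     (\<exists>(H :: ('i \<Rightarrow> complex) set) ip A \<tau> (Z :: ('i, 'n) op_matrix).
        faithful_normal_trace H ip A \<tau> \<and>
        (\<forall>i j. Z $ i $ j \<in> A \<and> complex_hilbert_space.positive_op H ip (Z $ i $ j)) \<and>
        (\<forall>X. \<Phi> X =
           opm_trace \<tau>
             (opm_mult (opm_mult Z (complex_hilbert_space.opm_ampliation H X))
                (complex_hilbert_space.opm_adj H ip Z))))"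

end

theory Submission
  imports Defs
begin

text \<open>
  Necessity: the entries of the Choi matrix are \<open>\<tau> (Z(k,i) Z(l,j)\<^sup>*)\<close>, and a positive trace is
  nonnegative on products of two positive operators.

  Sufficiency: two Kraus operators make the Choi matrix the Gram matrix of vectors in \<open>\<complex>\<^sup>2\<close> whose
  pairwise inner products are nonnegative. Such vectors lie, up to a unitary, in a quarter of a
  real plane, and another rotation puts them into the nonnegative quadrant. In other words,
  \<open>\<Phi>\<close> has two entrywise nonnegative Kraus operators, and these are the two coordinates of a matrix
  \<open>Z\<close> over the diagonal algebra \<open>\<complex>\<^sup>2\<close>, with the sum of the coordinates as trace.
\<close>

section \<open>Bounded operators\<close>

text \<open>Rank two is what makes sufficiency work. Nonnegativity of the Choi matrix is a condition
  on pairs of vectors, while entrywise nonnegative Kraus operators ask for one system of coordinates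
  that suits all of them. In a plane the vectors can be ordered by angle, and the coordinate axes
  are placed at an extreme one. In real dimension three, vectors with nonnegative inner products
  need not embed isometrically into any nonnegative orthant. The unitary and the rotation are never
  constructed: the coordinates are read off from Gram entries and 2x2 determinants, which all become
  real after one common change of phase. Necessity has to hold in an arbitrary algebra, where a
  product \<open>a b\<close> of positive operators is in general not positive. The usual identity
  tau(a b) = tau(a^(1/2) b a^(1/2)) is replaced by an iteration with polynomials in
  \<open>a\<close>.\<close>

context complex_hilbert_space
begin

lemma minus_eq_add_cscale: "x - y = x + cscale (-1) y"
  by (auto simp: cscale_def fun_eq_iff)

lemma cscale_add: "cscale c (x + y) = cscale c x + cscale c y"
  by (simp add: cscale_def fun_eq_iff distrib_left)

lemma cscale_cscale: "cscale c (cscale d x) = cscale (c * d) x"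
  by (simp add: cscale_def fun_eq_iff)

lemma cscale_zero: "cscale c 0 = 0"
  by (simp add: cscale_def fun_eq_iff)

lemma diff_closed: "x \<in> H \<Longrightarrow> y \<in> H \<Longrightarrow> x - y \<in> H"
  unfolding minus_eq_add_cscale by (intro add_closed scale_closed)

lemma ip_add_right: "x \<in> H \<Longrightarrow> y \<in> H \<Longrightarrow> z \<in> H \<Longrightarrow> ip x (y + z) = ip x y + ip x z"
  by (metis add_closed complex_cnj_add ip_add ip_commute)

lemma ip_scale_right: "x \<in> H \<Longrightarrow> y \<in> H \<Longrightarrow> ip x (cscale c y) = cnj c * ip x y"
  by (metis complex_cnj_mult ip_commute ip_scale scale_closed)

lemma ip_diff: "x \<in> H \<Longrightarrow> y \<in> H \<Longrightarrow> z \<in> H \<Longrightarrow> ip (x - y) z = ip x z - ip y z"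
  by (simp add: minus_eq_add_cscale ip_add scale_closed ip_scale)

lemma ip_diff_right: "x \<in> H \<Longrightarrow> y \<in> H \<Longrightarrow> z \<in> H \<Longrightarrow> ip x (y - z) = ip x y - ip x z"
  by (simp add: minus_eq_add_cscale ip_add_right scale_closed ip_scale_right)

lemma Re_ip_nonneg: "x \<in> H \<Longrightarrow> Re (ip x x) \<ge> 0"
  using ip_nonneg[of x] by (auto simp: complex_nonneg_Reals_iff)

lemma two_Re_ip_le:
  assumes "x \<in> H" "y \<in> H"
  shows "2 * Re (ip x y) \<le> Re (ip x x) + Re (ip y y)"
proof -
  have "Re (ip (x - y) (x - y)) \<ge> 0" by (intro Re_ip_nonneg diff_closed assms)
  moreover have "Re (ip y x) = Re (ip x y)" using ip_commute[OF assms] by simp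
  ultimately show ?thesis using assms by (simp add: ip_diff ip_diff_right diff_closed)
qed

lemma Re_ip_add_self_le:
  assumes "x \<in> H" "y \<in> H"
  shows "Re (ip (x + y) (x + y)) \<le> 2 * Re (ip x x) + 2 * Re (ip y y)"
proof -
  have "Re (ip y x) = Re (ip x y)" using ip_commute[OF assms] by simp
  then show ?thesis using assms two_Re_ip_le[OF assms]
    by (simp add: ip_add ip_add_right add_closed)
qed

lemma op_closed: "a \<in> bounded_ops \<Longrightarrow> x \<in> H \<Longrightarrow> a x \<in> H"
  by (simp add: bounded_ops_def)

lemma op_outside: "a \<in> bounded_ops \<Longrightarrow> x \<notin> H \<Longrightarrow> a x = 0"
  by (simp add: bounded_ops_def)

lemma op_add: "a \<in> bounded_ops \<Longrightarrow> x \<in> H \<Longrightarrow> y \<in> H \<Longrightarrow> a (x + y) = a x + a y"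
  by (simp add: bounded_ops_def)

lemma op_cscale: "a \<in> bounded_ops \<Longrightarrow> x \<in> H \<Longrightarrow> a (cscale c x) = cscale c (a x)"
  by (simp add: bounded_ops_def)

lemma op_zero: "a \<in> bounded_ops \<Longrightarrow> a 0 = 0"
  using op_add[of a 0 0] zero_closed by simp

text \<open>The squared form keeps square roots out of later estimates, and squaring makes the
  constant nonnegative, as the bound for a composition requires.\<close>

lemma op_bound:
  assumes "a \<in> bounded_ops"
  obtains K where "K \<ge> 0" "\<And>x. x \<in> H \<Longrightarrow> Re (ip (a x) (a x)) \<le> K * Re (ip x x)"
proof -
  obtain C where C: "\<And>x. x \<in> H \<Longrightarrow> hnorm (a x) \<le> C * hnorm x"
    using assms unfolding bounded_ops_def by blast
  have "Re (ip (a x) (a x)) \<le> C\<^sup>2 * Re (ip x x)" if x: "x \<in> H" for x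
  proof -
    have "hnorm (a x) \<ge> 0"
      using Re_ip_nonneg[OF op_closed[OF assms x]] by (simp add: hnorm_def)
    then have "(hnorm (a x))\<^sup>2 \<le> (C * hnorm x)\<^sup>2"
      using C[OF x] by (intro power_mono)
    then show ?thesis
      using Re_ip_nonneg[OF op_closed[OF assms x]] Re_ip_nonneg[OF x]
      by (simp add: hnorm_def power_mult_distrib)
  qed
  then show ?thesis using that[of "C\<^sup>2"] by simp
qed

lemma bounded_opsI:
  assumes "\<And>x. x \<in> H \<Longrightarrow> a x \<in> H" "\<And>x. x \<notin> H \<Longrightarrow> a x = 0"
    and "\<And>x y. x \<in> H \<Longrightarrow> y \<in> H \<Longrightarrow> a (x + y) = a x + a y"
    and "\<And>c x. x \<in> H \<Longrightarrow> a (cscale c x) = cscale c (a x)"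
    and "\<And>x. x \<in> H \<Longrightarrow> Re (ip (a x) (a x)) \<le> K * Re (ip x x)"
  shows "a \<in> bounded_ops"
proof -
  have "\<exists>C. \<forall>x\<in>H. hnorm (a x) \<le> C * hnorm x"
  proof (intro exI ballI)
    fix x assume "x \<in> H"
    then show "hnorm (a x) \<le> sqrt K * hnorm x"
      unfolding hnorm_def real_sqrt_mult[symmetric] by (intro real_sqrt_le_mono assms(5))
  qed
  then show ?thesis using assms(1-4) by (simp add: bounded_ops_def)
qed

lemma bounded_ops_add:
  assumes a: "a \<in> bounded_ops" and b: "b \<in> bounded_ops"
  shows "a + b \<in> bounded_ops"
proof -
  obtain K where K: "K \<ge> 0" "\<And>x. x \<in> H \<Longrightarrow> Re (ip (a x) (a x)) \<le> K * Re (ip x x)"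
    using op_bound[OF a] by metis
  obtain L where L: "L \<ge> 0" "\<And>x. x \<in> H \<Longrightarrow> Re (ip (b x) (b x)) \<le> L * Re (ip x x)"
    using op_bound[OF b] by metis
  show ?thesis
  proof (rule bounded_opsI[where K = "2 * K + 2 * L"])
    fix x assume x: "x \<in> H"
    show "Re (ip ((a + b) x) ((a + b) x)) \<le> (2 * K + 2 * L) * Re (ip x x)"
      using Re_ip_add_self_le[OF op_closed[OF a x] op_closed[OF b x]] K(2)[OF x] L(2)[OF x]
      by (simp add: algebra_simps)
  \<comment> \<open>Vectors are functions as well, so the general pointwise rules would take them
    apart. Only the instance for the two operators is unfolded.\<close>
  qed (simp_all add: plus_fun_apply[of a b] op_closed op_outside op_add op_cscale a b add_closed
      cscale_add add_ac del: plus_fun_apply zero_fun_apply)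
qed

lemma bounded_ops_comp:
  assumes a: "a \<in> bounded_ops" and b: "b \<in> bounded_ops"
  shows "a \<circ> b \<in> bounded_ops"
proof -
  obtain K where K: "K \<ge> 0" "\<And>x. x \<in> H \<Longrightarrow> Re (ip (a x) (a x)) \<le> K * Re (ip x x)"
    using op_bound[OF a] by metis
  obtain L where L: "L \<ge> 0" "\<And>x. x \<in> H \<Longrightarrow> Re (ip (b x) (b x)) \<le> L * Re (ip x x)"
    using op_bound[OF b] by metis
  show ?thesis
  proof (rule bounded_opsI[where K = "K * L"])
    fix x assume x: "x \<in> H"
    show "Re (ip ((a \<circ> b) x) ((a \<circ> b) x)) \<le> (K * L) * Re (ip x x)"
      using order_trans[OF K(2)[OF op_closed[OF b x]] mult_left_mono[OF L(2)[OF x] K(1)]]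
      by (simp add: algebra_simps)
  qed (simp_all add: op_closed op_outside op_add op_cscale op_zero a b del: plus_fun_apply zero_fun_apply)
qed

lemma bounded_ops_scale:
  assumes a: "a \<in> bounded_ops"
  shows "op_scale c a \<in> bounded_ops"
proof -
  obtain K where K: "K \<ge> 0" "\<And>x. x \<in> H \<Longrightarrow> Re (ip (a x) (a x)) \<le> K * Re (ip x x)"
    using op_bound[OF a] by metis
  show ?thesis
  proof (rule bounded_opsI[where K = "(cmod c)\<^sup>2 * K"])
    fix x assume x: "x \<in> H"
    have "ip (op_scale c a x) (op_scale c a x) = complex_of_real ((cmod c)\<^sup>2) * ip (a x) (a x)"
      unfolding op_scale_def complex_norm_square using op_closed[OF a x]
      by (simp add: ip_scale ip_scale_right scale_closed)
    then have "Re (ip (op_scale c a x) (op_scale c a x)) = (cmod c)\<^sup>2 * Re (ip (a x) (a x))"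
      by (simp only: Re_complex_of_real Im_complex_of_real times_complex.sel)
    then show "Re (ip (op_scale c a x) (op_scale c a x)) \<le> (cmod c)\<^sup>2 * K * Re (ip x x)"
      using mult_left_mono[OF K(2)[OF x], of "(cmod c)\<^sup>2"] by (simp add: mult.assoc)
  qed (simp_all add: op_scale_def op_closed op_outside op_add op_cscale a scale_closed
      cscale_add cscale_cscale cscale_zero mult.commute del: plus_fun_apply zero_fun_apply)
qed

lemma op_id_bounded: "op_id \<in> bounded_ops"
  by (rule bounded_opsI[where K = 1]) (auto simp: op_id_def add_closed scale_closed)

lemma minus_eq_op_scale: "a - b = a + op_scale (-1) b"
  by (auto simp: op_scale_def cscale_def fun_eq_iff)

lemma bounded_ops_diff: "a \<in> bounded_ops \<Longrightarrow> b \<in> bounded_ops \<Longrightarrow> a - b \<in> bounded_ops"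
  unfolding minus_eq_op_scale by (intro bounded_ops_add bounded_ops_scale)

lemma op_id_comp: "a \<in> bounded_ops \<Longrightarrow> op_id \<circ> a = a"
  by (auto simp: op_id_def fun_eq_iff bounded_ops_def zero_closed)

lemma comp_op_id: "a \<in> bounded_ops \<Longrightarrow> a \<circ> op_id = a"
  by (rule ext) (auto simp: op_id_def op_outside op_zero)

text \<open>\<open>a\<close> is additive only on \<open>H\<close>; outside \<open>H\<close> both
  \<open>b\<close> and \<open>c\<close> vanish and \<open>a 0 = 0\<close>. In
  \<open>add_comp\<close> the sum is on the left, where it is pointwise by definition.\<close>

lemma comp_add:
  assumes a: "a \<in> bounded_ops" and b: "b \<in> bounded_ops" and c: "c \<in> bounded_ops"
  shows "a \<circ> (b + c) = (a \<circ> b) + (a \<circ> c)"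
proof
  fix x show "(a \<circ> (b + c)) x = ((a \<circ> b) + (a \<circ> c)) x"
    using op_add[OF a op_closed[OF b] op_closed[OF c], of x x] op_zero[OF a]
    by (cases "x \<in> H") (simp_all add: op_outside[OF b] op_outside[OF c])
qed

lemma add_comp: "(a + b) \<circ> c = (a \<circ> c) + (b \<circ> c)"
  by (simp add: fun_eq_iff)

lemma op_scale_comp: "op_scale r a \<circ> b = op_scale r (a \<circ> b)"
  by (simp add: fun_eq_iff op_scale_def)

lemma comp_op_scale:
  assumes a: "a \<in> bounded_ops" and b: "b \<in> bounded_ops"
  shows "a \<circ> op_scale r b = op_scale r (a \<circ> b)"
proof
  fix x show "(a \<circ> op_scale r b) x = op_scale r (a \<circ> b) x"
    using op_zero[OF a] op_cscale[OF a op_closed[OF b], of x r]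
    by (cases "x \<in> H") (simp_all add: op_scale_def op_outside[OF b] cscale_zero)
qed

section \<open>Commutants and their closure properties\<close>

lemma commutant_bounded: "commutant S \<subseteq> bounded_ops"
  by (auto simp: commutant_def)

lemma commutant_add:
  assumes "S \<subseteq> bounded_ops" "a \<in> commutant S" "b \<in> commutant S"
  shows "a + b \<in> commutant S"
proof -
  have "c \<circ> (a + b) = (a + b) \<circ> c" if "c \<in> S" for c
  proof -
    have "c \<circ> (a + b) = (c \<circ> a) + (c \<circ> b)"
      using assms that by (intro comp_add) (auto simp: commutant_def)
    then show ?thesis using assms that unfolding add_comp by (simp add: commutant_def)
  qed
  then show ?thesis using assms by (simp add: commutant_def bounded_ops_add)
qed

lemma commutant_comp:
  assumes "S \<subseteq> bounded_ops" "a \<in> commutant S" "b \<in> commutant S"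
  shows "a \<circ> b \<in> commutant S"
proof -
  have "c \<circ> (a \<circ> b) = (a \<circ> b) \<circ> c" if "c \<in> S" for c
  proof -
    have "c \<circ> a = a \<circ> c" "c \<circ> b = b \<circ> c" using assms that by (auto simp: commutant_def)
    then show ?thesis by (metis comp_assoc)
  qed
  then show ?thesis using assms by (simp add: commutant_def bounded_ops_comp)
qed

lemma commutant_scale:
  assumes "S \<subseteq> bounded_ops" "a \<in> commutant S"
  shows "op_scale r a \<in> commutant S"
proof -
  have "c \<circ> op_scale r a = op_scale r a \<circ> c" if "c \<in> S" for c
  proof -
    have "c \<circ> op_scale r a = op_scale r (c \<circ> a)"
      using assms that by (intro comp_op_scale) (auto simp: commutant_def)
    also have "c \<circ> a = a \<circ> c" using assms that by (simp add: commutant_def)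
    finally show ?thesis by (simp only: op_scale_comp)
  qed
  then show ?thesis using assms by (simp add: commutant_def bounded_ops_scale)
qed

lemma commutant_op_id: "S \<subseteq> bounded_ops \<Longrightarrow> op_id \<in> commutant S"
  by (simp add: commutant_def op_id_bounded) (metis comp_op_id op_id_comp subsetD)

text \<open>\<open>op_adj\<close> is a definite description, so it is computed from a candidate
  \<open>b\<close> and uniqueness: the difference of two candidates at \<open>y\<close> is
  orthogonal to itself.\<close>

lemma op_adj_eqI:
  assumes b: "b \<in> bounded_ops" and adj: "\<And>x y. x \<in> H \<Longrightarrow> y \<in> H \<Longrightarrow> ip (a x) y = ip x (b y)"
  shows "op_adj a = b"
  unfolding op_adj_def
proof (rule the_equality)
  show "b \<in> bounded_ops \<and> (\<forall>x\<in>H. \<forall>y\<in>H. ip (a x) y = ip x (b y))"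
    by (intro conjI ballI b adj)
next
  fix c assume "c \<in> bounded_ops \<and> (\<forall>x\<in>H. \<forall>y\<in>H. ip (a x) y = ip x (c y))"
  then have c: "c \<in> bounded_ops" and adj': "\<And>x y. x \<in> H \<Longrightarrow> y \<in> H \<Longrightarrow> ip (a x) y = ip x (c y)"
    by simp_all
  show "c = b"
  proof
    fix y show "c y = b y"
    proof (cases "y \<in> H")
      case True
      have d: "c y - b y \<in> H" by (rule diff_closed[OF op_closed[OF c True] op_closed[OF b True]])
      have "ip (c y - b y) (c y) = ip (c y - b y) (b y)"
        by (rule trans[OF adj'[OF d True, symmetric] adj[OF d True]])
      then have "ip (c y - b y) (c y - b y) = 0"
        by (simp only: ip_diff_right[OF d op_closed[OF c True] op_closed[OF b True]] diff_self)
      then have "c y - b y = 0" by (rule ip_eq_0[OF d])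
      then show ?thesis by simp
    next
      case False
      then show ?thesis using op_outside[OF b] op_outside[OF c] by metis
    qed
  qed
qed

text \<open>Self-adjointness expressed by the inner product, so that it can be established before
  the value of \<open>op_adj\<close> is known.\<close>

definition symmetric_op :: "(('i \<Rightarrow> complex) \<Rightarrow> ('i \<Rightarrow> complex)) \<Rightarrow> bool" where
  "symmetric_op a \<longleftrightarrow> a \<in> bounded_ops \<and> (\<forall>x\<in>H. \<forall>y\<in>H. ip (a x) y = ip x (a y))"

lemma op_adj_symmetric: "symmetric_op a \<Longrightarrow> op_adj a = a"
  by (rule op_adj_eqI) (auto simp: symmetric_op_def)

lemma symmetric_op_add: "symmetric_op a \<Longrightarrow> symmetric_op b \<Longrightarrow> symmetric_op (a + b)"
  by (auto simp: symmetric_op_def bounded_ops_add ip_add ip_add_right op_closed)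

lemma symmetric_op_scale_real:
  "symmetric_op a \<Longrightarrow> symmetric_op (op_scale (complex_of_real r) a)"
  using bounded_ops_scale[of a "complex_of_real r"]
  by (auto simp: symmetric_op_def op_scale_def ip_scale ip_scale_right op_closed)

lemma positive_op_bounded: "positive_op a \<Longrightarrow> a \<in> bounded_ops"
  by (simp add: positive_op_def)

text \<open>Polarization: the form is real at \<open>x + y\<close>, which settles the imaginary
  parts, and at \<open>x + cscale \<i> y\<close>, which settles the real parts.\<close>

lemma positive_op_symmetric:
  assumes "positive_op a"
  shows "symmetric_op a"
  unfolding symmetric_op_def
proof (intro conjI ballI)
  show a: "a \<in> bounded_ops" using assms by (rule positive_op_bounded)
  fix x y assume x: "x \<in> H" and y: "y \<in> H"
  have im: "Im (ip (a z) z) = 0" if "z \<in> H" for z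
    using assms that by (auto simp: positive_op_def complex_nonneg_Reals_iff)
  have iy: "cscale \<i> y \<in> H" using y by (rule scale_closed)
  note simps = ip_add ip_add_right op_add[OF a] op_closed[OF a] add_closed ip_scale ip_scale_right
    op_cscale[OF a] x y scale_closed
  have "Im (ip (a x) y) + Im (ip (a y) x) = 0"
    using im[OF add_closed[OF x y]] im[OF x] im[OF y] by (simp add: simps)
  moreover have "Re (ip (a y) x) = Re (ip (a x) y)"
    using im[OF add_closed[OF x iy]] im[OF x] im[OF y] by (simp add: simps)
  moreover have "ip x (a y) = cnj (ip (a y) x)"
    using ip_commute[OF op_closed[OF a y] x] .
  ultimately show "ip (a x) y = ip x (a y)" by (simp add: complex_eq_iff)
qed

lemma positive_op_add: "positive_op a \<Longrightarrow> positive_op b \<Longrightarrow> positive_op (a + b)"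
  by (auto simp: positive_op_def bounded_ops_add ip_add op_closed)

lemma positive_op_scale:
  "positive_op a \<Longrightarrow> r \<ge> 0 \<Longrightarrow> positive_op (op_scale (complex_of_real r) a)"
  using bounded_ops_scale[of a "complex_of_real r"]
  by (auto simp: positive_op_def op_scale_def ip_scale op_closed)

lemma positive_op_square: "symmetric_op h \<Longrightarrow> positive_op (h \<circ> h)"
  by (simp add: symmetric_op_def positive_op_def bounded_ops_comp op_closed ip_nonneg)
    (metis ip_nonneg op_closed)

lemma positive_op_conjugate: "symmetric_op h \<Longrightarrow> positive_op b \<Longrightarrow> positive_op (h \<circ> b \<circ> h)"
  by (auto simp: symmetric_op_def positive_op_def bounded_ops_comp op_closed)

lemma op_diff_comp: "(a - b) \<circ> c = (a \<circ> c) - (b \<circ> c)"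
  by (simp add: fun_eq_iff)

lemma comp_diff:
  assumes "a \<in> bounded_ops" "b \<in> bounded_ops" "c \<in> bounded_ops"
  shows "a \<circ> (b - c) = (a \<circ> b) - (a \<circ> c)"
  using assms by (simp add: minus_eq_op_scale comp_add bounded_ops_scale comp_op_scale)

text \<open>Although \<open>a\<close> and \<open>1 - a\<close> commute, positivity of their product
  is not immediate. It follows from a - a^2 = a(1-a)a + (1-a)a(1-a), a sum of conjugates of positive
  operators; the second claim uses 1 - (a - a^2) = (1-a) + a^2.\<close>

lemma positive_op_minus_square:
  assumes "positive_op a" "positive_op (op_id - a)"
  shows "positive_op (a - (a \<circ> a))" "positive_op (op_id - (a - (a \<circ> a)))"
proof -
  have a: "a \<in> bounded_ops" using assms(1) by (rule positive_op_bounded)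
  note bd = a op_id_bounded bounded_ops_diff bounded_ops_comp
  have "a - (a \<circ> a) = (a \<circ> (op_id - a) \<circ> a) + ((op_id - a) \<circ> a \<circ> (op_id - a))"
    by (simp add: bd op_diff_comp comp_diff comp_op_id op_id_comp comp_assoc)
  then show "positive_op (a - (a \<circ> a))"
    using assms by (metis positive_op_add positive_op_conjugate positive_op_symmetric)
  have "op_id - (a - (a \<circ> a)) = (op_id - a) + (a \<circ> a)" by simp
  then show "positive_op (op_id - (a - (a \<circ> a)))"
    using assms by (metis positive_op_add positive_op_square positive_op_symmetric)
qed

text \<open>\<open>K + 1\<close> comes from \<open>two_Re_ip_le\<close> for \<open>a x\<close> and
  \<open>x\<close>, whose factor 2 may be dropped since \<open>ip (a x) x\<close> is nonnegative. It
  is positive even for \<open>a = 0\<close>, so one can divide by it.\<close>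

lemma positive_op_le_scale_id:
  assumes "positive_op a"
  obtains r where "r > 0" "positive_op (op_scale (complex_of_real r) op_id - a)"
proof -
  have a: "a \<in> bounded_ops" using assms by (rule positive_op_bounded)
  obtain K where K: "K \<ge> 0" "\<And>x. x \<in> H \<Longrightarrow> Re (ip (a x) (a x)) \<le> K * Re (ip x x)"
    using op_bound[OF a] by metis
  have "positive_op (op_scale (complex_of_real (K + 1)) op_id - a)"
    unfolding positive_op_def
  proof (intro conjI ballI bounded_ops_diff bounded_ops_scale op_id_bounded a)
    fix x assume x: "x \<in> H"
    have pos: "Re (ip (a x) x) \<ge> 0" "Im (ip (a x) x) = 0" "Im (ip x x) = 0"
      using assms ip_nonneg[OF x] x by (auto simp: positive_op_def complex_nonneg_Reals_iff)
    have "Re (ip (a x) x) \<le> (K + 1) * Re (ip x x)"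
      using two_Re_ip_le[OF op_closed[OF a x] x] K(2)[OF x] pos by (simp add: algebra_simps)
    then show "ip ((op_scale (complex_of_real (K + 1)) op_id - a) x) x \<in> \<real>\<^sub>\<ge>\<^sub>0"
      using x op_closed[OF a x] pos
      by (simp add: op_scale_def op_id_def ip_diff scale_closed ip_scale complex_nonneg_Reals_iff
        algebra_simps)
  qed
  then show ?thesis using that[of "K + 1"] K(1) by simp
qed

end

section \<open>Algebra operations in a von Neumann algebra\<close>

context von_neumann_algebra
begin

lemma vna_bounded: "a \<in> A \<Longrightarrow> a \<in> bounded_ops"
  using bounded by blast

text \<open>\<open>A\<close> is an algebra because it is the commutant of
  \<open>commutant A\<close>, a set of bounded operators; the same argument gives products,
  multiples and the identity.\<close>

lemma vna_add: "a \<in> A \<Longrightarrow> b \<in> A \<Longrightarrow> a + b \<in> A"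
  using commutant_add[OF commutant_bounded, of a A b] bicommutant by simp

lemma vna_comp: "a \<in> A \<Longrightarrow> b \<in> A \<Longrightarrow> a \<circ> b \<in> A"
  using commutant_comp[OF commutant_bounded, of a A b] bicommutant by simp

lemma vna_scale: "a \<in> A \<Longrightarrow> op_scale r a \<in> A"
  using commutant_scale[OF commutant_bounded, of a A r] bicommutant by simp

lemma vna_op_id: "op_id \<in> A"
  using commutant_op_id[OF commutant_bounded, of A] bicommutant by simp

lemma vna_diff: "a \<in> A \<Longrightarrow> b \<in> A \<Longrightarrow> a - b \<in> A"
  by (simp add: minus_eq_op_scale vna_add vna_scale)

lemma vna_zero: "0 \<in> A"
  using vna_diff[OF vna_op_id vna_op_id] by simp

lemma vna_sum: "(\<And>i. i \<in> I \<Longrightarrow> f i \<in> A) \<Longrightarrow> sum f I \<in> A"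
  by (induction I rule: infinite_finite_induct) (auto simp: vna_zero vna_add)

end

section \<open>The trace of a product of positive operators\<close>

context faithful_normal_trace
begin

lemma trace_diff: "a \<in> A \<Longrightarrow> b \<in> A \<Longrightarrow> \<tau> (a - b) = \<tau> a - \<tau> b"
  by (simp add: minus_eq_op_scale trace_add vna_scale trace_scale)

lemma trace_zero: "\<tau> 0 = 0"
  using trace_diff[OF vna_op_id vna_op_id] by simp

lemma trace_sum: "(\<And>i. i \<in> I \<Longrightarrow> f i \<in> A) \<Longrightarrow> \<tau> (sum f I) = (\<Sum>i\<in>I. \<tau> (f i))"
  by (induction I rule: infinite_finite_induct) (auto simp: trace_zero trace_add vna_sum)

lemma trace_square_nonneg:
  assumes "a \<in> A" "symmetric_op a"
  shows "\<tau> (a \<circ> a) \<in> \<real>\<^sub>\<ge>\<^sub>0"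
  using assms by (intro trace_positive vna_comp positive_op_square)

lemma trace_square_add:
  assumes a: "a \<in> A" and b: "b \<in> A"
  shows "\<tau> ((a + b) \<circ> (a + b)) = \<tau> (a \<circ> a) + 2 * \<tau> (a \<circ> b) + \<tau> (b \<circ> b)"
proof -
  have "(a + b) \<circ> (a + b) = (a \<circ> a) + (a \<circ> b) + ((b \<circ> a) + (b \<circ> b))"
    using a b by (simp add: comp_add add_comp vna_bounded bounded_ops_add add_ac)
  then show ?thesis
    using a b trace_commute[OF a b] by (simp add: trace_add vna_add vna_comp)
qed

text \<open>By \<open>trace_square_add\<close>, twice this trace is a combination of traces of
  squares of symmetric operators, which are real.\<close>

lemma trace_comp_real:
  assumes "a \<in> A" "symmetric_op a" "b \<in> A" "symmetric_op b"
  shows "Im (\<tau> (a \<circ> b)) = 0"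
proof -
  have "\<tau> ((a + b) \<circ> (a + b)) \<in> \<real>\<^sub>\<ge>\<^sub>0"
    using assms by (intro trace_square_nonneg vna_add symmetric_op_add)
  then show ?thesis
    using trace_square_nonneg[OF assms(1,2)] trace_square_nonneg[OF assms(3,4)]
    by (simp add: trace_square_add assms complex_nonneg_Reals_iff)
qed

text \<open>The Cauchy-Schwarz inequality for the form \<tau>(a b), kept as a quadratic in
  \<open>t\<close> so that a convenient \<open>t\<close> can be inserted later.\<close>

lemma trace_quadratic_nonneg:
  assumes "a \<in> A" "symmetric_op a" "b \<in> A" "symmetric_op b"
  shows "Re (\<tau> (a \<circ> a)) + 2 * t * Re (\<tau> (a \<circ> b)) + t\<^sup>2 * Re (\<tau> (b \<circ> b)) \<ge> 0"
proof -
  let ?b = "op_scale (complex_of_real t) b"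
  have bA: "?b \<in> A" using assms by (intro vna_scale)
  have e1: "\<tau> (a \<circ> ?b) = t * \<tau> (a \<circ> b)"
    using assms by (simp add: comp_op_scale vna_bounded trace_scale vna_comp)
  have e2: "\<tau> (?b \<circ> ?b) = t * (t * \<tau> (b \<circ> b))"
    using assms by (simp add: comp_op_scale op_scale_comp vna_bounded trace_scale vna_comp
      vna_scale bounded_ops_scale)
  have "\<tau> ((a + ?b) \<circ> (a + ?b)) \<in> \<real>\<^sub>\<ge>\<^sub>0"
    using assms bA by (intro trace_square_nonneg vna_add symmetric_op_add symmetric_op_scale_real)
  then show ?thesis
    unfolding trace_square_add[OF assms(1) bA] e1 e2
    by (simp add: complex_nonneg_Reals_iff power2_eq_square algebra_simps)
qed

text \<open>Square roots are avoided: for \<open>0 \<le> a \<le> 1\<close> the iteration \<open>a \<mapsto> a - a\<^sup>2\<close> preserves these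
  bounds and never increases \<open>\<tau> (a b)\<close>, as \<open>\<tau> (a\<^sup>2 b) = \<tau> (a b a) \<ge> 0\<close>. Since \<open>\<tau> a\<close> decreases by
  \<open>\<tau> (a\<^sup>2)\<close> in each step, \<open>\<tau> (a\<^sup>2)\<close> tends to \<open>0\<close> along the iteration, so \<open>\<tau> (a b)\<close> cannot stay
  below a negative constant.\<close>

lemma trace_comp_contraction_nonneg:
  assumes a: "a \<in> A" "positive_op a" "positive_op (op_id - a)" and b: "b \<in> A" "positive_op b"
  shows "Re (\<tau> (a \<circ> b)) \<ge> 0"
proof (rule ccontr)
  define s where "s n = ((\<lambda>x. x - (x \<circ> x)) ^^ n) a" for n
  have s0: "s 0 = a" and sS: "s (Suc n) = s n - (s n \<circ> s n)" for n
    by (simp_all add: s_def)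
  have s: "s n \<in> A \<and> positive_op (s n) \<and> positive_op (op_id - s n)" for n
  proof (induction n)
    case 0
    show ?case unfolding s0 by (intro conjI a)
  next
    case (Suc n)
    then have "s n \<in> A" and pos: "positive_op (s n)" "positive_op (op_id - s n)" by blast+
    then show ?case
      unfolding sS by (intro conjI vna_diff vna_comp positive_op_minus_square[OF pos])
  qed
  have sym: "symmetric_op (s n)" for n using s positive_op_symmetric by blast
  define c where "c n = Re (\<tau> (s n \<circ> b))" for n
  define q where "q n = Re (\<tau> (s n \<circ> s n))" for n
  have "c (Suc n) \<le> c n" for n
  proof -
    have "\<tau> (s (Suc n) \<circ> b) = \<tau> (s n \<circ> b) - \<tau> (s n \<circ> (s n \<circ> b))"
      using s b by (simp add: sS op_diff_comp trace_diff vna_comp comp_assoc)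
    also have "\<tau> (s n \<circ> (s n \<circ> b)) = \<tau> (s n \<circ> b \<circ> s n)"
      using s b by (intro trace_commute vna_comp) auto
    finally have "c (Suc n) = c n - Re (\<tau> (s n \<circ> b \<circ> s n))"
      by (simp only: c_def minus_complex.sel)
    moreover have "\<tau> (s n \<circ> b \<circ> s n) \<in> \<real>\<^sub>\<ge>\<^sub>0"
      using s b sym by (intro trace_positive vna_comp positive_op_conjugate) auto
    ultimately show ?thesis by (simp add: complex_nonneg_Reals_iff)
  qed
  then have "c n \<le> c 0" for n using decseq_SucI[of c] by (auto simp: decseq_def)
  have tn: "Re (\<tau> (s n)) \<ge> 0" for n
    using s trace_positive[of "s n"] by (simp add: complex_nonneg_Reals_iff)
  have tS: "Re (\<tau> (s (Suc n))) = Re (\<tau> (s n)) - q n" for n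
    using s by (simp add: sS q_def trace_diff vna_comp)
  have "(\<Sum>k<n. q k) = Re (\<tau> (s 0)) - Re (\<tau> (s n))" for n
    by (induction n) (simp_all add: tS)
  then have bound: "(\<Sum>k<n. q k) \<le> Re (\<tau> a)" for n
    using tn[of n] by (simp add: s0)
  have "q n \<ge> 0" for n
    using trace_square_nonneg[of "s n"] s sym by (simp add: q_def complex_nonneg_Reals_iff)
  then have "summable q" using bound by (intro summableI_nonneg_bounded) auto
  then have lim: "q \<longlonglongrightarrow> 0" by (rule summable_LIMSEQ_zero)
  define B where "B = Re (\<tau> (b \<circ> b))"
  have B: "B \<ge> 0"
    using trace_square_nonneg[of b] b positive_op_symmetric
    by (simp add: B_def complex_nonneg_Reals_iff)
  assume "\<not> Re (\<tau> (a \<circ> b)) \<ge> 0"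
  then have neg: "c 0 < 0" by (simp add: c_def s0)
  \<comment> \<open>The lower bound for \<open>q n\<close> below is largest at
    \<open>- c 0 / B\<close>. The denominator \<open>B + 1\<close> allows for \<open>B = 0\<close>
    and keeps \<open>t * B\<close> below \<open>- c 0\<close>, so the lower bound is positive,
    although \<open>q\<close> tends to 0.\<close>
  define t where "t = - c 0 / (B + 1)"
  have t: "t > 0" using neg B by (simp add: t_def divide_neg_pos)
  have "- 2 * t * c 0 - t\<^sup>2 * B \<le> q n" for n
  proof -
    have "q n + 2 * t * c n + t\<^sup>2 * B \<ge> 0"
      using trace_quadratic_nonneg[of "s n" b t] s sym b positive_op_symmetric
      by (simp add: q_def c_def B_def)
    moreover have "t * c n \<le> t * c 0" using \<open>c n \<le> c 0\<close> t by simp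
    ultimately show ?thesis by linarith
  qed
  then have "- 2 * t * c 0 - t\<^sup>2 * B \<le> 0" using lim by (intro LIMSEQ_le_const) auto
  then have "t * (- 2 * c 0 - t * B) \<le> 0" by (simp add: power2_eq_square algebra_simps)
  then have "- 2 * c 0 \<le> t * B" using t by (simp add: mult_le_0_iff)
  moreover have "t * B \<le> t * (B + 1)" using t by simp
  moreover have "t * (B + 1) = - c 0" using B by (simp add: t_def)
  ultimately show False using neg by linarith
qed

text \<open>Dividing \<open>a\<close> by an upper bound \<open>r\<close> makes it a contraction, and
  the positive factor \<open>1 / r\<close> comes out of the trace.\<close>

lemma trace_comp_positive:
  assumes "a \<in> A" "positive_op a" "b \<in> A" "positive_op b"
  shows "\<tau> (a \<circ> b) \<in> \<real>\<^sub>\<ge>\<^sub>0"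
proof -
  obtain r where r: "r > 0" "positive_op (op_scale (complex_of_real r) op_id - a)"
    by (rule positive_op_le_scale_id[OF assms(2)])
  let ?a = "op_scale (complex_of_real (1 / r)) a"
  have "op_id - ?a = op_scale (complex_of_real (1 / r)) (op_scale (complex_of_real r) op_id - a)"
    using r(1) by (simp add: fun_eq_iff op_scale_def cscale_def field_simps)
  then have "positive_op (op_id - ?a)"
    using positive_op_scale[OF r(2), of "1 / r"] r(1) by simp
  then have "Re (\<tau> (?a \<circ> b)) \<ge> 0"
    using assms r(1) by (intro trace_comp_contraction_nonneg vna_scale positive_op_scale) auto
  then have "Re (\<tau> (a \<circ> b)) \<ge> 0"
    using assms r(1) by (simp add: op_scale_comp trace_scale vna_comp zero_le_divide_iff
        flip: of_real_inverse of_real_divide)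
  then show ?thesis
    using trace_comp_real assms positive_op_symmetric by (simp add: complex_nonneg_Reals_iff)
qed

text \<open>Both directions read the map through this formula: the coefficient of
  \<open>X $ i $ j\<close> in the entry \<open>(k, l)\<close> is the Choi entry at
  \<open>(i, k)\<close>, \<open>(j, l)\<close>.\<close>

lemma opm_trace_factorization:
  fixes Z :: "('i, 'n::finite) op_matrix"
  assumes Z: "\<And>i j. Z $ i $ j \<in> A"
  shows "opm_trace \<tau> (opm_mult (opm_mult Z (opm_ampliation X)) (opm_adj Z)) $ k $ l =
    (\<Sum>j\<in>UNIV. \<Sum>i\<in>UNIV. X $ i $ j * \<tau> (Z $ k $ i \<circ> op_adj (Z $ l $ j)))"
proof -
  have sc: "sum f I \<circ> g = (\<Sum>i\<in>I. f i \<circ> g)"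
    for f :: "'n \<Rightarrow> ('i \<Rightarrow> complex) \<Rightarrow> 'i \<Rightarrow> complex" and I g
    by (induction I rule: infinite_finite_induct) (simp_all add: fun_eq_iff)
  have "opm_mult (opm_mult Z (opm_ampliation X)) (opm_adj Z) $ k $ l =
    (\<Sum>j\<in>UNIV. \<Sum>i\<in>UNIV. op_scale (X $ i $ j) (Z $ k $ i \<circ> op_adj (Z $ l $ j)))"
    unfolding opm_mult_def opm_adj_def opm_ampliation_def
    by (simp add: sc comp_op_scale comp_op_id Z vna_bounded op_id_bounded op_scale_comp)
  then show ?thesis
    unfolding opm_trace_def
    by (simp add: trace_sum vna_sum vna_scale vna_comp Z adj_closed trace_scale)
qed

end

text \<open>The order of summation, \<open>j\<close> outside, is that of
  \<open>opm_trace_factorization\<close> and \<open>kraus_representation_nth\<close>, so one rule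
  extracts Choi entries from both.\<close>

lemma sum_matrix_unit:
  "(\<Sum>j\<in>UNIV. \<Sum>i\<in>UNIV. matrix_unit a b $ i $ j * f i j) = f (a::'n::finite) (b::'n)"
proof -
  have "matrix_unit a b $ i $ j * f i j = (if i = a then if j = b then f i j else 0 else 0)" for i j
    by (simp add: matrix_unit_def)
  then show ?thesis by (simp add: sum.delta)
qed

lemma positively_factorizable_choi_nonneg:
  fixes \<Phi> :: "complex^'n::finite^'n \<Rightarrow> complex^'n^'n"
  assumes "positively_factorizable TYPE('i) \<Phi>"
  shows "choi \<Phi> $ p $ q \<in> \<real>\<^sub>\<ge>\<^sub>0"
proof -
  obtain H ip A \<tau> and Z :: "('i, 'n) op_matrix" where tr: "faithful_normal_trace H ip A \<tau>"
    and Z: "\<And>i j. Z $ i $ j \<in> A" "\<And>i j. complex_hilbert_space.positive_op H ip (Z $ i $ j)"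
    and \<Phi>: "\<And>X. \<Phi> X = opm_trace \<tau> (opm_mult (opm_mult Z
        (complex_hilbert_space.opm_ampliation H X)) (complex_hilbert_space.opm_adj H ip Z))"
    using assms unfolding positively_factorizable_def by blast
  interpret faithful_normal_trace H ip A \<tau> by (rule tr)
  obtain i k j l where pq: "p = (i, k)" "q = (j, l)" by (cases p, cases q)
  have "choi \<Phi> $ p $ q = \<Phi> (matrix_unit i j) $ k $ l" by (simp add: pq choi_nth)
  also have "\<dots> = (\<Sum>b\<in>UNIV. \<Sum>a\<in>UNIV.
      matrix_unit i j $ a $ b * \<tau> (Z $ k $ a \<circ> op_adj (Z $ l $ b)))"
    unfolding \<Phi> by (rule opm_trace_factorization) (rule Z)
  also have "\<dots> = \<tau> (Z $ k $ i \<circ> op_adj (Z $ l $ j))" by (rule sum_matrix_unit)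
  also have "op_adj (Z $ l $ j) = Z $ l $ j"
    by (intro op_adj_symmetric positive_op_symmetric Z)
  finally show ?thesis by (simp only: trace_comp_positive[OF Z Z])
qed

section \<open>The algebra of diagonal operators\<close>

text \<open>The space \<complex>^S, realised inside \<open>'i \<Rightarrow> complex\<close> where
  all Hilbert spaces of the development live.\<close>

definition supported :: "'i set \<Rightarrow> ('i \<Rightarrow> complex) set" where
  "supported S = {x. \<forall>i. i \<notin> S \<longrightarrow> x i = 0}"

definition sum_ip :: "'i set \<Rightarrow> ('i \<Rightarrow> complex) \<Rightarrow> ('i \<Rightarrow> complex) \<Rightarrow> complex" where
  "sum_ip S x y = (\<Sum>i\<in>S. x i * cnj (y i))"

definition basis_vec :: "'i \<Rightarrow> 'i \<Rightarrow> complex" where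
  "basis_vec i = (\<lambda>j. if j = i then 1 else 0)"

text \<open>Multiplication by \<open>f\<close>, cut off to 0 outside the space as the convention for
  operators demands. Only the values of \<open>f\<close> on \<open>S\<close> matter, see
  \<open>diag_op_cong\<close>.\<close>

definition diag_op :: "'i set \<Rightarrow> ('i \<Rightarrow> complex) \<Rightarrow> ('i \<Rightarrow> complex) \<Rightarrow> ('i \<Rightarrow> complex)" where
  "diag_op S f = (\<lambda>x. if x \<in> supported S then (\<lambda>i. f i * x i) else 0)"

text \<open>Recovers the multiplier from an operator that is given only as a function, so that a
  trace can be defined on operators.\<close>

definition diag_entry :: "(('i \<Rightarrow> complex) \<Rightarrow> ('i \<Rightarrow> complex)) \<Rightarrow> 'i \<Rightarrow> complex" where
  "diag_entry a = (\<lambda>i. a (basis_vec i) i)"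

definition diag_trace :: "'i set \<Rightarrow> (('i \<Rightarrow> complex) \<Rightarrow> ('i \<Rightarrow> complex)) \<Rightarrow> complex" where
  "diag_trace S a = (\<Sum>i\<in>S. diag_entry a i)"

lemma sum_nonneg_Reals: "(\<And>i. i \<in> I \<Longrightarrow> f i \<in> \<real>\<^sub>\<ge>\<^sub>0) \<Longrightarrow> sum f I \<in> \<real>\<^sub>\<ge>\<^sub>0"
  by (induction I rule: infinite_finite_induct) auto

lemma sum_ip_self: "sum_ip S x x = complex_of_real (\<Sum>i\<in>S. (cmod (x i))\<^sup>2)"
  unfolding sum_ip_def of_real_sum complex_norm_square ..

lemma basis_vec_supported: "i \<in> S \<Longrightarrow> basis_vec i \<in> supported S"
  by (auto simp: basis_vec_def supported_def)

lemma diag_op_supported: "diag_op S f x \<in> supported S"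
  by (simp add: diag_op_def supported_def)

lemma diag_op_apply: "x \<in> supported S \<Longrightarrow> diag_op S f x i = f i * x i"
  by (simp add: diag_op_def)

lemma diag_op_outside: "x \<notin> supported S \<Longrightarrow> diag_op S f x = 0"
  by (simp add: diag_op_def)

lemma diag_entry_diag_op: "i \<in> S \<Longrightarrow> diag_entry (diag_op S f) i = f i"
  by (simp add: diag_entry_def diag_op_apply[OF basis_vec_supported]) (simp add: basis_vec_def)

lemma diag_trace_diag_op: "diag_trace S (diag_op S f) = (\<Sum>i\<in>S. f i)"
  unfolding diag_trace_def by (intro sum.cong refl) (rule diag_entry_diag_op)

lemma diag_op_cong:
  assumes "\<And>i. i \<in> S \<Longrightarrow> f i = g i"
  shows "diag_op S f = diag_op S g"
proof (intro ext)
  fix x i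
  have "f i * x i = g i * x i" if "x \<in> supported S"
    using assms[of i] that by (cases "i \<in> S") (auto simp: supported_def)
  then show "diag_op S f x i = diag_op S g x i" by (simp add: diag_op_def)
qed

lemma diag_op_zero: "diag_op S (\<lambda>i. 0) = 0"
  by (simp add: diag_op_def fun_eq_iff)

lemma diag_op_comp: "diag_op S f \<circ> diag_op S g = diag_op S (\<lambda>i. f i * g i)"
proof
  fix x show "(diag_op S f \<circ> diag_op S g) x = diag_op S (\<lambda>i. f i * g i) x"
    by (cases "x \<in> supported S")
      (auto simp: fun_eq_iff diag_op_apply diag_op_supported diag_op_outside,
       auto simp: diag_op_def)
qed

lemma diag_op_add: "diag_op S f + diag_op S g = diag_op S (\<lambda>i. f i + g i)"
  by (auto simp: fun_eq_iff diag_op_def algebra_simps)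

lemma diag_op_diff: "diag_op S f - diag_op S g = diag_op S (\<lambda>i. f i - g i)"
  by (auto simp: fun_eq_iff diag_op_def algebra_simps)

lemma complex_hilbert_space_supported:
  assumes S: "finite S"
  shows "complex_hilbert_space (supported S) (sum_ip S)"
proof
  fix X :: "nat \<Rightarrow> 'a \<Rightarrow> complex"
  assume X: "\<And>n. X n \<in> supported S"
    and cauchy: "\<And>e. e > 0 \<Longrightarrow>
      \<exists>N. \<forall>m\<ge>N. \<forall>n\<ge>N. sqrt (Re (sum_ip S (X m - X n) (X m - X n))) < e"
  \<comment> \<open>Coordinates are dominated by the norm, so a Cauchy sequence converges in each of
    them; finiteness of \<open>S\<close> turns this back into convergence in norm.\<close>
  have le: "cmod (z i) \<le> sqrt (Re (sum_ip S z z))" if "i \<in> S" for z i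
  proof -
    have "(cmod (z i))\<^sup>2 \<le> (\<Sum>i\<in>S. (cmod (z i))\<^sup>2)"
      using S that by (intro member_le_sum) auto
    then show ?thesis by (simp add: sum_ip_self real_le_rsqrt)
  qed
  have "convergent (\<lambda>n. X n i)" if i: "i \<in> S" for i
  proof (intro Cauchy_convergent metric_CauchyI)
    fix e :: real assume "e > 0"
    then obtain N where "\<forall>m\<ge>N. \<forall>n\<ge>N. sqrt (Re (sum_ip S (X m - X n) (X m - X n))) < e"
      using cauchy by blast
    moreover have "dist (X m i) (X n i) \<le> sqrt (Re (sum_ip S (X m - X n) (X m - X n)))" for m n
      using le[OF i, of "X m - X n"] by (simp add: dist_norm)
    ultimately show "\<exists>M. \<forall>m\<ge>M. \<forall>n\<ge>M. dist (X m i) (X n i) < e"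
      by (meson le_less_trans)
  qed
  then have "\<exists>L. (\<lambda>n. X n i) \<longlonglongrightarrow> L" if "i \<in> S" for i
    using that by (auto simp: convergent_def)
  then obtain l where l: "\<And>i. i \<in> S \<Longrightarrow> (\<lambda>n. X n i) \<longlonglongrightarrow> l i" by metis
  \<comment> \<open>The chosen \<open>l\<close> is arbitrary outside \<open>S\<close>. Cutting it
    off puts the limit into the space and leaves the norms, which see only \<open>S\<close>,
    unchanged.\<close>
  define l' where "l' = (\<lambda>i. if i \<in> S then l i else 0)"
  have "(\<lambda>n. sqrt (\<Sum>i\<in>S. (cmod (X n i - l i))\<^sup>2)) \<longlonglongrightarrow> sqrt (\<Sum>i\<in>S. (cmod (l i - l i))\<^sup>2)"
    by (intro tendsto_intros l)
  also have "(\<lambda>n. sqrt (\<Sum>i\<in>S. (cmod (X n i - l i))\<^sup>2)) =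
      (\<lambda>n. sqrt (Re (sum_ip S (X n - l') (X n - l'))))"
    by (simp add: sum_ip_self l'_def)
  finally show "\<exists>l\<in>supported S. (\<lambda>n. sqrt (Re (sum_ip S (X n - l) (X n - l)))) \<longlonglongrightarrow> 0"
    by (intro bexI[of _ l']) (auto simp: supported_def l'_def)
next
  fix x :: "'a \<Rightarrow> complex"
  assume x: "x \<in> supported S" and "sum_ip S x x = 0"
  then have "(\<Sum>i\<in>S. (cmod (x i))\<^sup>2) = 0" by (simp only: sum_ip_self of_real_eq_0_iff)
  then have "\<forall>i\<in>S. x i = 0" using S by (subst (asm) sum_nonneg_eq_0_iff) auto
  then show "x = 0" using x by (auto simp: supported_def fun_eq_iff)
next
  fix x :: "'a \<Rightarrow> complex"
  show "sum_ip S x x \<in> \<real>\<^sub>\<ge>\<^sub>0"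
    unfolding sum_ip_self nonneg_Reals_of_real_iff by (intro sum_nonneg) simp
qed (auto simp: supported_def cscale_def sum_ip_def sum.distrib sum_distrib_left algebra_simps)

locale finite_coordinates =
  fixes S :: "'i set"
  assumes finite_S: "finite S"
begin

sublocale complex_hilbert_space "supported S" "sum_ip S"
  by (rule complex_hilbert_space_supported) (rule finite_S)

lemma diag_op_bounded: "diag_op S f \<in> bounded_ops"
proof (rule bounded_opsI[where K = "\<Sum>i\<in>S. (cmod (f i))\<^sup>2"])
  fix x assume x: "x \<in> supported S"
  have "(\<Sum>i\<in>S. (cmod (diag_op S f x i))\<^sup>2) \<le> (\<Sum>i\<in>S. (\<Sum>i\<in>S. (cmod (f i))\<^sup>2) * (cmod (x i))\<^sup>2)"
  proof (intro sum_mono)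
    fix i assume i: "i \<in> S"
    have "(cmod (f i))\<^sup>2 \<le> (\<Sum>i\<in>S. (cmod (f i))\<^sup>2)"
      using finite_S i by (intro member_le_sum) auto
    then show "(cmod (diag_op S f x i))\<^sup>2 \<le> (\<Sum>i\<in>S. (cmod (f i))\<^sup>2) * (cmod (x i))\<^sup>2"
      using x by (simp add: diag_op_apply norm_mult power_mult_distrib mult_right_mono)
  qed
  then show "Re (sum_ip S (diag_op S f x) (diag_op S f x)) \<le>
      (\<Sum>i\<in>S. (cmod (f i))\<^sup>2) * Re (sum_ip S x x)"
    by (simp add: sum_ip_self sum_distrib_left)
next
  fix x y assume "x \<in> supported S" "y \<in> supported S"
  then show "diag_op S f (x + y) = diag_op S f x + diag_op S f y"
    using add_closed[of x y] by (simp add: diag_op_def fun_eq_iff distrib_left)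
next
  fix c x assume "x \<in> supported S"
  then show "diag_op S f (cscale c x) = cscale c (diag_op S f x)"
    using scale_closed[of x c] by (simp add: diag_op_def cscale_def fun_eq_iff)
qed (rule diag_op_supported, rule diag_op_outside)

lemma op_adj_diag_op: "op_adj (diag_op S f) = diag_op S (\<lambda>i. cnj (f i))"
  by (rule op_adj_eqI[OF diag_op_bounded])
    (auto simp: sum_ip_def diag_op_apply intro!: sum.cong)

lemma op_scale_diag_op: "op_scale c (diag_op S f) = diag_op S (\<lambda>i. c * f i)"
  by (auto simp: op_scale_def cscale_def diag_op_def fun_eq_iff)

lemma positive_diag_op_iff: "positive_op (diag_op S f) \<longleftrightarrow> (\<forall>i\<in>S. f i \<in> \<real>\<^sub>\<ge>\<^sub>0)"
proof
  assume pos: "positive_op (diag_op S f)"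
  show "\<forall>i\<in>S. f i \<in> \<real>\<^sub>\<ge>\<^sub>0"
  proof
    fix i assume i: "i \<in> S"
    have "sum_ip S (diag_op S f (basis_vec i)) (basis_vec i) = (\<Sum>j\<in>S. if j = i then f j else 0)"
      unfolding sum_ip_def diag_op_apply[OF basis_vec_supported[OF i]]
      by (intro sum.cong refl) (simp add: basis_vec_def)
    also have "\<dots> = f i" using finite_S i by simp
    finally show "f i \<in> \<real>\<^sub>\<ge>\<^sub>0" using pos basis_vec_supported[OF i] by (auto simp: positive_op_def)
  qed
next
  assume f: "\<forall>i\<in>S. f i \<in> \<real>\<^sub>\<ge>\<^sub>0"
  have "sum_ip S (diag_op S f x) x \<in> \<real>\<^sub>\<ge>\<^sub>0" if x: "x \<in> supported S" for x
  proof -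
    have "sum_ip S (diag_op S f x) x = (\<Sum>i\<in>S. f i * complex_of_real ((cmod (x i))\<^sup>2))"
      unfolding sum_ip_def diag_op_apply[OF x] complex_norm_square by (simp add: mult.assoc)
    moreover have "f i * complex_of_real ((cmod (x i))\<^sup>2) \<in> \<real>\<^sub>\<ge>\<^sub>0" if "i \<in> S" for i
      using f that by (intro nonneg_Reals_mult_I) auto
    ultimately show ?thesis by (simp only: sum_nonneg_Reals)
  qed
  then show "positive_op (diag_op S f)" by (simp add: positive_op_def diag_op_bounded)
qed

text \<open>The diagonal algebra is maximal abelian; applied twice, this gives the bicommutant
  condition.\<close>

lemma commutant_diag_op: "commutant (range (diag_op S)) = range (diag_op S)"
proof
  show "range (diag_op S) \<subseteq> commutant (range (diag_op S))"
    by (auto simp: commutant_def diag_op_bounded diag_op_comp mult.commute)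
  show "commutant (range (diag_op S)) \<subseteq> range (diag_op S)"
  proof
    fix b assume "b \<in> commutant (range (diag_op S))"
    then have b: "b \<in> bounded_ops" and comm: "\<And>f. diag_op S f \<circ> b = b \<circ> diag_op S f"
      by (auto simp: commutant_def)
    have "b x i = diag_op S (diag_entry b) x i" for x i
    proof (cases "x \<in> supported S \<and> i \<in> S")
      case True
      then have x: "x \<in> supported S" and i: "i \<in> S" by auto
      \<comment> \<open>\<open>basis_vec i\<close> is both the diagonal of the projection onto
        coordinate \<open>i\<close> and the vector spanning its range. Commuting with this
        projection makes coordinate \<open>i\<close> of \<open>b x\<close> depend on
        \<open>x i\<close> alone.\<close>
      have "diag_op S (basis_vec i) x = cscale (x i) (basis_vec i)"
        unfolding fun_eq_iff diag_op_apply[OF x] by (simp add: basis_vec_def cscale_def)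
      then have "diag_op S (basis_vec i) (b x) = cscale (x i) (b (basis_vec i))"
        using fun_cong[OF comm[of "basis_vec i"], of x]
          op_cscale[OF b basis_vec_supported[OF i], of "x i"] by simp
      from fun_cong[OF this, of i] show ?thesis
        unfolding diag_op_apply[OF op_closed[OF b x]] diag_op_apply[OF x]
        by (simp add: basis_vec_def cscale_def diag_entry_def)
    next
      case False
      then show ?thesis
      proof (cases "x \<in> supported S")
        case True
        then have "i \<notin> S" using False by blast
        then show ?thesis using op_closed[OF b True] diag_op_supported[of S "diag_entry b" x]
          by (simp add: supported_def)
      next
        case False
        then show ?thesis using op_outside[OF b] by (simp add: diag_op_outside)
      qed
    qed
    then show "b \<in> range (diag_op S)" by (metis ext rangeI)
  qed
qed

text \<open>Comparing \<open>s\<close> with the diagonal operator of the coordinatewise suprema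
  \<open>u\<close> bounds each \<open>F s i\<close> by \<open>u i\<close>. Directedness and
  finiteness of \<open>S\<close> then give one \<open>d\<close> in \<open>D\<close> close to
  \<open>s\<close> in all coordinates at once, so that sum and supremum can be exchanged.\<close>

lemma normal_diag_trace:
  assumes D: "D \<subseteq> {d \<in> range (diag_op S). positive_op d}" "D \<noteq> {}"
    and directed: "\<And>a b. a \<in> D \<Longrightarrow> b \<in> D \<Longrightarrow> \<exists>c\<in>D. op_le a c \<and> op_le b c"
    and s: "s \<in> range (diag_op S)" and upper: "\<And>d. d \<in> D \<Longrightarrow> op_le d s"
    and least: "\<And>b. b \<in> range (diag_op S) \<Longrightarrow> (\<And>d. d \<in> D \<Longrightarrow> op_le d b) \<Longrightarrow> op_le s b"
  shows "Re (diag_trace S s) = (SUP d\<in>D. Re (diag_trace S d))"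
proof -
  define F where "F d i = Re (diag_entry d i)" for d :: "('i \<Rightarrow> complex) \<Rightarrow> 'i \<Rightarrow> complex" and i
  have le: "F a i \<le> F b i"
    if "op_le a b" "a \<in> range (diag_op S)" "b \<in> range (diag_op S)" "i \<in> S" for a b i
    using that by (auto simp: F_def op_le_def diag_op_diff positive_diag_op_iff diag_entry_diag_op
        complex_nonneg_Reals_iff)
  have tr: "Re (diag_trace S d) = (\<Sum>i\<in>S. F d i)" for d
    by (simp add: diag_trace_def F_def)
  have DA: "d \<in> range (diag_op S)" if "d \<in> D" for d using D that by blast
  define u where "u i = (SUP d\<in>D. F d i)" for i
  have bdd: "bdd_above ((\<lambda>d. F d i) ` D)" if "i \<in> S" for i
    using le[OF upper DA s that] by (intro bdd_aboveI2)
  \<comment> \<open>\<open>op_le\<close> also requires the difference to be real; positivity of the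
    members of \<open>D\<close> ensures this.\<close>
  have "op_le d (diag_op S (\<lambda>i. complex_of_real (u i)))" if d: "d \<in> D" for d
  proof -
    obtain f where f: "d = diag_op S f" using DA[OF d] by blast
    have "positive_op (diag_op S f)" using D d f by auto
    then have fi: "f i \<in> \<real>\<^sub>\<ge>\<^sub>0" if "i \<in> S" for i using that by (simp add: positive_diag_op_iff)
    have "F d i \<le> u i" if "i \<in> S" for i
      unfolding u_def using d bdd[OF that] by (rule cSUP_upper)
    then show ?thesis using fi
      by (auto simp: op_le_def f diag_op_diff positive_diag_op_iff F_def diag_entry_diag_op
        complex_nonneg_Reals_iff)
  qed
  then have "op_le s (diag_op S (\<lambda>i. complex_of_real (u i)))" by (intro least) auto
  then have su: "F s i \<le> u i" if "i \<in> S" for i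
    using le[OF _ s _ that, of "diag_op S (\<lambda>i. complex_of_real (u i))"] that
    by (simp add: F_def diag_entry_diag_op)
  \<comment> \<open>In the insertion step an element good on \<open>T\<close> and one good at
    \<open>i\<close> are dominated by a common \<open>c\<close> in \<open>D\<close>.\<close>
  have approx: "\<exists>d\<in>D. \<forall>i\<in>T. F s i - e \<le> F d i" if "finite T" "T \<subseteq> S" "e > 0" for T e
    using that
  proof (induction T rule: finite_induct)
    case empty
    then show ?case using D(2) by auto
  next
    case (insert i T)
    then obtain d where d: "d \<in> D" "\<forall>j\<in>T. F s j - e \<le> F d j" by auto
    have i: "i \<in> S" using insert by auto
    have "F s i - e < u i" using su[OF i] insert by simp
    then obtain d' where d': "d' \<in> D" "F s i - e < F d' i"
      unfolding u_def using less_cSUP_iff[OF D(2) bdd[OF i]] by blast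
    obtain c where c: "c \<in> D" "op_le d c" "op_le d' c" using directed[OF d(1) d'(1)] by blast
    have "F s j - e \<le> F c j" if "j \<in> insert i T" for j
    proof (cases "j = i")
      case True
      then show ?thesis using d' le[OF c(3) DA[OF d'(1)] DA[OF c(1)] i] by simp
    next
      case False
      then have j: "j \<in> T" "j \<in> S" using that insert by auto
      then show ?thesis using d(2) le[OF c(2) DA[OF d(1)] DA[OF c(1)] j(2)] by fastforce
    qed
    then show ?case using c(1) by blast
  qed
  have ds: "(\<Sum>i\<in>S. F d i) \<le> (\<Sum>i\<in>S. F s i)" if "d \<in> D" for d
    by (intro sum_mono le[OF upper[OF that] DA[OF that] s])
  have bddt: "bdd_above ((\<lambda>d. \<Sum>i\<in>S. F d i) ` D)" using ds by (rule bdd_aboveI2)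
  have "(\<Sum>i\<in>S. F s i) = (SUP d\<in>D. \<Sum>i\<in>S. F d i)"
  proof (rule antisym)
    show "(SUP d\<in>D. \<Sum>i\<in>S. F d i) \<le> (\<Sum>i\<in>S. F s i)"
      using D(2) ds by (rule cSUP_least)
    show "(\<Sum>i\<in>S. F s i) \<le> (SUP d\<in>D. \<Sum>i\<in>S. F d i)"
    proof (rule field_le_epsilon)
      fix e :: real assume e: "e > 0"
      define e' where "e' = e / (real (card S) + 1)"
      have e': "e' > 0" using e by (simp add: e'_def add_nonneg_pos)
      obtain d where d: "d \<in> D" "\<forall>i\<in>S. F s i - e' \<le> F d i"
        using approx[OF finite_S order_refl e'] by blast
      have "(\<Sum>i\<in>S. F s i - e') \<le> (\<Sum>i\<in>S. F d i)" using d by (intro sum_mono) auto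
      then have "(\<Sum>i\<in>S. F s i) \<le> (\<Sum>i\<in>S. F d i) + real (card S) * e'"
        by (simp add: sum_subtractf)
      also have "(\<Sum>i\<in>S. F d i) \<le> (SUP d\<in>D. \<Sum>i\<in>S. F d i)"
        using d(1) bddt by (rule cSUP_upper)
      also have "real (card S) * e' \<le> e" using e by (simp add: e'_def field_simps)
      finally show "(\<Sum>i\<in>S. F s i) \<le> (SUP d\<in>D. \<Sum>i\<in>S. F d i) + e" by simp
    qed
  qed
  then show ?thesis by (simp add: tr)
qed

lemma faithful_normal_diag_trace:
  "faithful_normal_trace (supported S) (sum_ip S) (range (diag_op S)) (diag_trace S)"
proof
  show "range (diag_op S) \<subseteq> bounded_ops" using diag_op_bounded by blast
  show "commutant (commutant (range (diag_op S))) = range (diag_op S)"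
    by (simp only: commutant_diag_op)
  fix a assume "a \<in> range (diag_op S)"
  then obtain f where f: "a = diag_op S f" by blast
  show "op_adj a \<in> range (diag_op S)" unfolding f op_adj_diag_op by blast
  \<comment> \<open>Finiteness of the algebra is commutativity.\<close>
  show "a \<circ> op_adj a = op_id" if "op_adj a \<circ> a = op_id"
    using that unfolding f op_adj_diag_op diag_op_comp by (simp add: mult.commute)
  show "diag_trace S (op_scale c a) = c * diag_trace S a" for c
    unfolding f op_scale_diag_op diag_trace_diag_op by (simp add: sum_distrib_left)
  show "diag_trace S a \<in> \<real>\<^sub>\<ge>\<^sub>0" if "positive_op a"
    using that unfolding f positive_diag_op_iff diag_trace_diag_op
    by (intro sum_nonneg_Reals) simp
  show "a = 0" if "positive_op a" "diag_trace S a = 0"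
  proof -
    have pos: "\<forall>i\<in>S. Re (f i) \<ge> 0 \<and> Im (f i) = 0"
      using that(1) unfolding f positive_diag_op_iff by (simp add: complex_nonneg_Reals_iff)
    have "(\<Sum>i\<in>S. Re (f i)) = 0"
      using that(2) unfolding f diag_trace_diag_op by (metis Re_sum zero_complex.sel(1))
    then have "\<forall>i\<in>S. Re (f i) = 0"
      using pos finite_S by (subst (asm) sum_nonneg_eq_0_iff) auto
    then show ?thesis
      using pos unfolding f diag_op_zero[of S, symmetric]
      by (intro diag_op_cong) (simp add: complex_eq_iff)
  qed
  fix b assume "b \<in> range (diag_op S)"
  then obtain g where g: "b = diag_op S g" by blast
  show "diag_trace S (a + b) = diag_trace S a + diag_trace S b"
    unfolding f g diag_op_add diag_trace_diag_op by (rule sum.distrib)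
  show "diag_trace S (a \<circ> b) = diag_trace S (b \<circ> a)"
    unfolding f g diag_op_comp by (simp add: mult.commute)
qed (rule normal_diag_trace; blast)

end

text \<open>Any finite family of entrywise nonnegative Kraus operators \<open>W r\<close> is
  allowed, with one coordinate of the diagonal algebra for each \<open>r\<close>; the trace performs
  the Kraus sum.\<close>

lemma positively_factorizable_of_nonneg_kraus:
  fixes \<Phi> :: "complex^'n::finite^'n \<Rightarrow> complex^'n^'n" and W :: "'i \<Rightarrow> 'n \<Rightarrow> 'n \<Rightarrow> real"
  assumes S: "finite S" and W: "\<And>r k i. W r k i \<ge> 0"
    and \<Phi>: "\<And>X k l. \<Phi> X $ k $ l =
      (\<Sum>j\<in>UNIV. \<Sum>i\<in>UNIV. X $ i $ j * (\<Sum>r\<in>S. complex_of_real (W r k i * W r l j)))"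
  shows "positively_factorizable TYPE('i) \<Phi>"
proof -
  interpret finite_coordinates S by unfold_locales (rule S)
  interpret tr: faithful_normal_trace "supported S" "sum_ip S" "range (diag_op S)" "diag_trace S"
    by (rule faithful_normal_diag_trace)
  define Z :: "('i, 'n) op_matrix" where
    "Z = (\<chi> k i. diag_op S (\<lambda>r. complex_of_real (W r k i)))"
  have Z: "Z $ k $ i = diag_op S (\<lambda>r. complex_of_real (W r k i))" for k i by (simp add: Z_def)
  have "\<Phi> X = opm_trace (diag_trace S) (opm_mult (opm_mult Z (opm_ampliation X)) (opm_adj Z))" for X
  proof -
    have "opm_trace (diag_trace S) (opm_mult (opm_mult Z (opm_ampliation X)) (opm_adj Z)) $ k $ l
        = \<Phi> X $ k $ l" for k l
      by (subst tr.opm_trace_factorization)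
        (auto simp: Z op_adj_diag_op diag_op_comp diag_trace_diag_op \<Phi>)
    then show ?thesis by (simp add: vec_eq_iff)
  qed
  moreover have "Z $ k $ i \<in> range (diag_op S) \<and> positive_op (Z $ k $ i)" for k i
    unfolding Z positive_diag_op_iff using W by simp
  ultimately show ?thesis
    unfolding positively_factorizable_def using faithful_normal_diag_trace by blast
qed

section \<open>Nonnegative Gram matrices of rank two\<close>

text \<open>All cross products \<open>C p q\<close> of the given vectors become real after multiplication by a common
  phase \<open>c\<close>. Their signs order the nonzero vectors by angle; this is transitive by the Pluecker
  relation because the inner products \<open>g p q\<close> are nonnegative. The coordinates are taken with
  respect to a least vector \<open>u\<close>.\<close>

lemma nonneg_gram_planar:
  fixes v w :: "'p::finite \<Rightarrow> complex"
  assumes nonneg: "\<And>p q. v p * cnj (v q) + w p * cnj (w q) \<in> \<real>\<^sub>\<ge>\<^sub>0"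
  obtains x y :: "'p \<Rightarrow> real" where "\<And>p. x p \<ge> 0" "\<And>p. y p \<ge> 0"
    "\<And>p q. v p * cnj (v q) + w p * cnj (w q) = complex_of_real (x p * x q + y p * y q)"
proof -
  define g where "g p q = Re (v p * cnj (v q) + w p * cnj (w q))" for p q
  have G: "v p * cnj (v q) + w p * cnj (w q) = complex_of_real (g p q)" and g: "g p q \<ge> 0" for p q
    using nonneg[of p q] unfolding g_def complex_nonneg_Reals_iff by (auto simp: complex_eq_iff)
  have gsym: "g p q = g q p" for p q by (simp add: g_def algebra_simps)
  define C where "C p q = v p * w q - w p * v q" for p q
  \<comment> \<open>The Cauchy-Binet identity: the product is a 2x2 minor of the Gram matrix. It is
    therefore real, so the nonzero \<open>C p q\<close> agree in phase up to sign.\<close>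
  have lagrange: "C p q * cnj (C r s) = complex_of_real (g p r * g q s - g p s * g q r)" for p q r s
    unfolding of_real_diff of_real_mult G[symmetric] C_def by (simp add: algebra_simps)
  have "\<exists>c. c * cnj c = 1 \<and> (\<forall>p q. c * C p q \<in> \<real>)"
  proof (cases "\<forall>p q. C p q = 0")
    case True
    then show ?thesis by (intro exI[of _ 1]) simp
  next
    case False
    then obtain a b where ab: "C a b \<noteq> 0" by blast
    \<comment> \<open>The inverse phase of one nonzero determinant; by \<open>lagrange\<close> it
      serves for all others.\<close>
    define c where "c = cnj (C a b) / complex_of_real (cmod (C a b))"
    have "c * cnj c = (C a b * cnj (C a b)) / (complex_of_real (cmod (C a b)))\<^sup>2"
      by (simp add: c_def power2_eq_square mult.commute)
    then have "c * cnj c = 1" using ab by (simp add: complex_norm_square[symmetric])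
    moreover have "c * C p q \<in> \<real>" for p q
    proof -
      have "c * C p q = (C p q * cnj (C a b)) / complex_of_real (cmod (C a b))"
        by (simp add: c_def mult.commute)
      then show ?thesis unfolding lagrange by simp
    qed
    ultimately show ?thesis by blast
  qed
  then obtain c where c: "c * cnj c = 1" "\<And>p q. c * C p q \<in> \<real>" by blast
  define R where "R p q = Re (c * C p q)" for p q
  have R: "complex_of_real (R p q) = c * C p q" for p q
    unfolding R_def using c(2) by (rule of_real_Re)
  have Rsym: "R q p = - R p q" for p q by (simp add: R_def C_def algebra_simps)
  have RR: "R p q * R r s = g p r * g q s - g p s * g q r" for p q r s
  proof -
    have "complex_of_real (R p q * R r s) = (c * C p q) * cnj (c * C r s)"
      unfolding of_real_mult R[of p q] by (simp add: R[symmetric])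
    also have "\<dots> = (c * cnj c) * (C p q * cnj (C r s))" by simp
    finally show ?thesis unfolding c(1) lagrange by (simp only: mult_1 of_real_eq_iff)
  qed
  \<comment> \<open>Three vectors of a plane satisfy C(p,r) q = C(q,r) p + C(p,q) r; this is the
    inner product of that relation with \<open>q\<close>, times the phase \<open>c\<close>.\<close>
  have plucker: "g q q * R p r = g p q * R q r + g r q * R p q" for p q r
  proof -
    have "complex_of_real (g q q * R p r) = complex_of_real (g p q * R q r + g r q * R p q)"
      unfolding of_real_mult of_real_add R G[symmetric] C_def by (simp add: algebra_simps)
    then show ?thesis by (simp only: of_real_eq_iff)
  qed
  have zero: "v p = 0 \<and> w p = 0" if "g p p = 0" for p
  proof -
    have "(cmod (v p))\<^sup>2 + (cmod (w p))\<^sup>2 = 0"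
      using that by (simp add: g_def cmod_def power2_eq_square)
    then show ?thesis by (simp add: sum_power2_eq_zero_iff)
  qed
  show ?thesis
  proof (cases "\<forall>p. g p p = 0")
    case True
    then show ?thesis using zero by (intro that[of "\<lambda>_. 0" "\<lambda>_. 0"]) auto
  next
    case False
    \<comment> \<open>Zero vectors are left out: they are comparable with everything in both
      directions and would break transitivity.\<close>
    have minimal: "\<exists>u\<in>F. \<forall>q\<in>F. R u q \<ge> 0" if "finite F" "F \<noteq> {}" "\<forall>p\<in>F. g p p \<noteq> 0" for F
      using that
    proof (induction F rule: finite_ne_induct)
      case (singleton p)
      have "R p p = 0" by (simp add: R_def C_def)
      then show ?case by simp
    next
      case (insert a F)
      then obtain u where u: "u \<in> F" "\<forall>q\<in>F. R u q \<ge> 0" by auto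
      show ?case
      proof (cases "R u a \<ge> 0")
        case True
        then show ?thesis using u by auto
      next
        case False
        have "R a q \<ge> 0" if "q \<in> F" for q
        proof -
          have "R a u \<ge> 0" using False Rsym[of u a] by simp
          \<comment> \<open>With \<open>u\<close> as the middle vector: \<open>a\<close> precedes
            \<open>u\<close> and \<open>u\<close> precedes \<open>q\<close>, so both terms on the
            right are nonnegative.\<close>
          then have "g u u * R a q \<ge> 0"
            unfolding plucker[of u a q] using g u that by simp
          moreover have "g u u \<noteq> 0" using insert.prems u(1) by blast
          then have "g u u > 0" using g[of u u] by simp
          ultimately show ?thesis by (simp add: zero_le_mult_iff)
        qed
        moreover have "R a a = 0" by (simp add: R_def C_def)
        ultimately show ?thesis by simp
      qed
    qed
    have "\<exists>u\<in>{p. g p p \<noteq> 0}. \<forall>q\<in>{p. g p p \<noteq> 0}. R u q \<ge> 0"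
      by (rule minimal) (use False in auto)
    then obtain u where u: "g u u \<noteq> 0" and min: "\<And>q. g q q \<noteq> 0 \<Longrightarrow> R u q \<ge> 0" by blast
    have pos: "R u q \<ge> 0" for q
      using min[of q] zero[of q] by (cases "g q q = 0") (auto simp: R_def C_def)
    show ?thesis
    \<comment> \<open>The components along \<open>u\<close> and orthogonal to it, the latter as
      signed area divided by length. \<open>RR\<close> with \<open>u\<close> in both first places
      gives the Gram entry, and leastness of \<open>u\<close> gives the sign of the second
      component.\<close>
    proof (rule that[of "\<lambda>p. g p u / sqrt (g u u)" "\<lambda>p. R u p / sqrt (g u u)"])
      fix p q
      show "g p u / sqrt (g u u) \<ge> 0" "R u p / sqrt (g u u) \<ge> 0" using g pos by simp_all
      have "g p u / sqrt (g u u) * (g q u / sqrt (g u u)) + R u p / sqrt (g u u) * (R u q / sqrt (g u u))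
          = (g p u * g q u + R u p * R u q) / g u u"
        using g[of u u] by (simp add: add_divide_distrib)
      also have "\<dots> = g p q"
        unfolding RR using u by (simp add: gsym[of u p] gsym[of u q] mult.commute)
      finally show "v p * cnj (v q) + w p * cnj (w q) = complex_of_real
          (g p u / sqrt (g u u) * (g q u / sqrt (g u u)) + R u p / sqrt (g u u) * (R u q / sqrt (g u u)))"
        unfolding G by (rule arg_cong[OF sym])
    qed
  qed
qed

section \<open>Kraus representations and the Choi matrix\<close>

text \<open>The infimum is attained because \<open>enat\<close> is well-ordered, and a finite value
  excludes the empty set, whose infimum is \<open>\<infinity>\<close>.\<close>

lemma choi_rank_eq_enatD:
  assumes "choi_rank \<Phi> = enat d"
  obtains K where "independent_matrices d K" "kraus_representation \<Phi> d K"
proof -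
  let ?D = "{d. \<exists>K. independent_matrices d K \<and> kraus_representation \<Phi> d K}"
  have "?D \<noteq> {}"
  proof
    assume "?D = {}"
    then have "choi_rank \<Phi> = \<infinity>"
      unfolding choi_rank_def by (simp only: image_empty Inf_empty top_enat_def)
    then show False using assms by simp
  qed
  then obtain m where "enat m \<in> enat ` ?D" by blast
  then have "Inf (enat ` ?D) \<in> enat ` ?D" by (rule wellorder_InfI)
  then obtain e where "e \<in> ?D" "choi_rank \<Phi> = enat e" unfolding choi_rank_def by blast
  then have "d \<in> ?D" using assms by simp
  then show ?thesis using that by blast
qed

lemma kraus_representation_nth:
  assumes "kraus_representation \<Phi> d K"
  shows "\<Phi> X $ k $ l =
    (\<Sum>j\<in>UNIV. \<Sum>i\<in>UNIV. X $ i $ j * (\<Sum>r<d. K r $ k $ i * cnj (K r $ l $ j)))"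
proof -
  have "\<Phi> X $ k $ l = (\<Sum>r<d. \<Sum>j\<in>UNIV. \<Sum>i\<in>UNIV. X $ i $ j * (K r $ k $ i * cnj (K r $ l $ j)))"
    using assms by (simp add: kraus_representation_def matrix_matrix_mult_def ctranspose_def
        sum_distrib_left mult_ac)
  also have "\<dots> = (\<Sum>j\<in>UNIV. \<Sum>r<d. \<Sum>i\<in>UNIV. X $ i $ j * (K r $ k $ i * cnj (K r $ l $ j)))"
    by (rule sum.swap)
  also have "\<dots> = (\<Sum>j\<in>UNIV. \<Sum>i\<in>UNIV. \<Sum>r<d. X $ i $ j * (K r $ k $ i * cnj (K r $ l $ j)))"
    by (intro sum.cong refl) (rule sum.swap)
  finally show ?thesis by (simp only: sum_distrib_left)
qed

theorem theorem6p2: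
  fixes \<Phi> :: "complex^'n::finite^'n \<Rightarrow> complex^'n^'n"
  assumes "completely_positive \<Phi>"
    and "choi_rank \<Phi> = 2"
  shows "positively_factorizable TYPE('i::infinite) \<Phi> \<longleftrightarrow>
    (\<forall>p q. choi \<Phi> $ p $ q \<in> \<real>\<^sub>\<ge>\<^sub>0)"
proof
  assume "positively_factorizable TYPE('i) \<Phi>"
  then show "\<forall>p q. choi \<Phi> $ p $ q \<in> \<real>\<^sub>\<ge>\<^sub>0"
    by (intro allI positively_factorizable_choi_nonneg)
next
  assume nonneg: "\<forall>p q. choi \<Phi> $ p $ q \<in> \<real>\<^sub>\<ge>\<^sub>0"
  have "choi_rank \<Phi> = enat 2" using assms(2) by (simp add: numeral_eq_enat)
  then obtain K where K: "kraus_representation \<Phi> 2 K" by (rule choi_rank_eq_enatD)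
  \<comment> \<open>A Choi index is a pair (input, output), whereas a matrix has its output index
    first; hence the swap of \<open>fst\<close> and \<open>snd\<close>.\<close>
  define v where "v r p = K r $ snd p $ fst p" for r and p :: "'n \<times> 'n"
  have two: "(\<Sum>r<2. f r) = f 0 + f 1" for f :: "nat \<Rightarrow> complex"
    by (simp add: numeral_2_eq_2)
  have gram: "v 0 p * cnj (v 0 q) + v 1 p * cnj (v 1 q) \<in> \<real>\<^sub>\<ge>\<^sub>0" for p q
  proof -
    have "choi \<Phi> $ p $ q = \<Phi> (matrix_unit (fst p) (fst q)) $ snd p $ snd q"
      using choi_nth[of \<Phi> "fst p" "snd p" "fst q" "snd q"] by simp
    also have "\<dots> = v 0 p * cnj (v 0 q) + v 1 p * cnj (v 1 q)"
      unfolding kraus_representation_nth[OF K] sum_matrix_unit two v_def ..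
    finally show ?thesis using nonneg by metis
  qed
  obtain x y where xy: "\<And>p. x p \<ge> 0" "\<And>p. y p \<ge> 0"
    "\<And>p q. v 0 p * cnj (v 0 q) + v 1 p * cnj (v 1 q) = complex_of_real (x p * x q + y p * y q)"
    by (rule nonneg_gram_planar[of "v 0" "v 1", OF gram]) blast
  \<comment> \<open>Two distinct indices carry the two coordinates: \<open>x\<close> sits at
    \<open>s\<close>, \<open>y\<close> at \<open>t\<close>.\<close>
  obtain s t :: 'i where t: "t \<noteq> s" using arb_element[of "{undefined}"] by auto
  define W where "W r k i = (if r = s then x (i, k) else y (i, k))" for r :: 'i and k i
  show "positively_factorizable TYPE('i) \<Phi>"
  proof (rule positively_factorizable_of_nonneg_kraus[of "{s, t}" W])
    show "W r k i \<ge> 0" for r k i by (simp add: W_def xy)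
    have "(\<Sum>r<2. K r $ k $ i * cnj (K r $ l $ j)) =
        (\<Sum>r\<in>{s, t}. complex_of_real (W r k i * W r l j))" for k i l j
      using xy(3)[of "(i, k)" "(j, l)"] t by (simp add: two v_def W_def)
    then show "\<Phi> X $ k $ l = (\<Sum>j\<in>UNIV. \<Sum>i\<in>UNIV. X $ i $ j *
        (\<Sum>r\<in>{s, t}. complex_of_real (W r k i * W r l j)))" for X k l
      unfolding kraus_representation_nth[OF K] by simp
  qed simp
qed

end
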